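(* Let $p=(p_k)_{k\ge0}$ be a probability distribution on $\mathbb{N}_0$ with $p_0=0$, $p_1<1$, $m_{\mathtt{BGW}}=\sum_k kp_k<\infty$, let $\omega$ have law $\mathtt{BGW}$ (Bienaymé–Galton–Watson tree with offspring law $p$), and let $d_{\min}:=\min\{k:p_k>0\}$. Let $\lambda>0$ and let $(X(u),u\in\mathbb{T})$ be the $\lambda$-biased branching random walk on $\omega$ with reproduction law $\mu$, where $\mu_0=0$, $\mu_1<1$, $m=\sum_k k\mu_k\in(1,\infty)$. For a vertex $x$ of $\omega$ let $$\alpha_x:=\mathbf{P}_\omega\big(\forall n\in\mathbb{N}\ \exists u\in\mathbb{T}: |u|\ge n,\ X(u)=x \,\big|\, X(\varnothing)=x\big).$$ Then for $\mathtt{BGW}$-a.e. $\omega$: the branching random walk is transient in the sense that $\alpha_x=0$ for all $x\in\omega$ if and only if $$\lambda<d_{\min}\quad\text{and}\quad m\le\frac{d_{\min}+\lambda}{2\sqrt{\lambda d_{\min}}}.$$ Otherwise, i.e. if $\lambda\ge d_{\min}$ or $m>\frac{d_{\min}+\lambda}{2\sqrt{\lambda d_{\min}}}$, the branching random walk is strongly recurrent: $\alpha_x=1$ for all $x\in\omega$.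
   Context: $\varrho$ is the root of $\omega$; $|x|$ is the distance of $x$ to $\varrho$, $x_-$ the parent and $\kappa_x$ the number of children of $x$. The $\lambda$-biased random walk on $\omega$ jumps from $\varrho$ to each child of $\varrho$ with probability $1/\kappa_\varrho$, and from $x\ne\varrho$ to $x_-$ with probability $\lambda/(\lambda+\kappa_x)$ and to each child of $x$ with probability $1/(\lambda+\kappa_x)$. The $\lambda$-biased branching random walk: the genealogy $\mathbb{T}$ is a Bienaymé–Galton–Watson tree with offspring law $\mu$ (root $\varnothing$, $|u|$ the generation of $u$) independent of $\omega$; given $\omega$, each child of a particle at $x$ is placed independently at a position chosen by one step of the $\lambda$-biased random walk from $x$. $\mathbf{P}_\omega$ is the quenched law given $\omega$. *)

theory Defs
  imports "HOL-Probability.Probability"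
begin

text \<open>Rooted locally finite trees are encoded in Ulam-Harris form: vertices are
  nat lists, the root is the empty list, the parent of x is butlast x, and an
  offspring function kappa gives the number of children kappa x of every
  (potential) vertex x.  The tree consists of the words all of whose letters are
  admissible.\<close>

definition in_tree :: "(nat list \<Rightarrow> nat) \<Rightarrow> nat list \<Rightarrow> bool" where
  "in_tree \<kappa> x \<longleftrightarrow> (\<forall>k<length x. x ! k < \<kappa> (take k x))"

definition bgw :: "nat pmf \<Rightarrow> (nat list \<Rightarrow> nat) measure" where
  "bgw p = PiM UNIV (\<lambda>_::nat list. measure_pmf p)"

definition lb_step :: "(nat list \<Rightarrow> nat) \<Rightarrow> real \<Rightarrow> nat list \<Rightarrow> nat list pmf" where
  "lb_step \<kappa> lam x =
     (if x = [] then map_pmf (\<lambda>i. x @ [i]) (pmf_of_set {..<\<kappa> x})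
      else bind_pmf (bernoulli_pmf (lam / (lam + real (\<kappa> x))))
             (\<lambda>b. if b then return_pmf (butlast x)
                  else map_pmf (\<lambda>i. x @ [i]) (pmf_of_set {..<\<kappa> x})))"

text \<open>Quenched law of the branching random walk: i.i.d. offspring numbers nu u
  (law mu) for the genealogy, and for every individual u and every possible parent
  position y an independent step xi (u, y) drawn from the biased walk kernel at y;
  the child u occupies xi (u, position of its parent).\<close>
definition brw_space :: "(nat list \<Rightarrow> nat) \<Rightarrow> real \<Rightarrow> nat pmf
    \<Rightarrow> ((nat list \<Rightarrow> nat) \<times> (nat list \<times> nat list \<Rightarrow> nat list)) measure" where
  "brw_space \<kappa> lam \<mu> =
     pair_measure (PiM UNIV (\<lambda>_::nat list. measure_pmf \<mu>))
                  (PiM UNIV (\<lambda>(u, y). measure_pmf (lb_step \<kappa> lam y)))"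

primrec pos_rev :: "(nat list \<times> nat list \<Rightarrow> nat list) \<Rightarrow> nat list \<Rightarrow> nat list \<Rightarrow> nat list" where
  "pos_rev \<xi> x0 [] = x0"
| "pos_rev \<xi> x0 (i # r) = \<xi> (rev (i # r), pos_rev \<xi> x0 r)"

definition brw_pos :: "(nat list \<times> nat list \<Rightarrow> nat list) \<Rightarrow> nat list \<Rightarrow> nat list \<Rightarrow> nat list" where
  "brw_pos \<xi> x0 u = pos_rev \<xi> x0 (rev u)"

definition brw_alpha :: "(nat list \<Rightarrow> nat) \<Rightarrow> real \<Rightarrow> nat pmf \<Rightarrow> nat list \<Rightarrow> real" where
  "brw_alpha \<kappa> lam \<mu> x = measure (brw_space \<kappa> lam \<mu>)
     {(\<nu>, \<xi>). \<forall>n. \<exists>u. in_tree \<nu> u \<and> n \<le> length u \<and> brw_pos \<xi> x u = x}"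

definition dmin :: "nat pmf \<Rightarrow> nat" where
  "dmin p = (LEAST k. pmf p k > 0)"

end

theory Submission
  imports Defs
begin

text \<open>Write \<open>P\<close> for the transition operator of the walk, \<open>G\<close> for the generating function of \<open>\<mu>\<close> and \<open>q y\<close> for
  the probability that no particle of the branching walk started at \<open>y\<close> ever visits \<open>x\<close>. The branching property
  gives \<open>q \<le> G (P q) \<le> P q\<close>, and since \<open>G s < s\<close> on the open unit interval, \<open>sup q < 1\<close> already forces \<open>q = 0\<close>,
  which is strong recurrence.

  Let \<open>d\<close> be the minimal degree and \<open>\<rho> = 2 * sqrt (lam * d) / (d + lam)\<close>.
  If \<open>lam < d\<close> and \<open>m * \<rho> \<le> 1\<close>, the function \<open>f y = sqrt (lam / d) ^ |y|\<close> satisfies \<open>m * P f \<le> f\<close>, strictly at the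
  root, so the expected number of visits to every vertex is finite, also in the critical case.

  Otherwise one uses finite patterns of degrees carrying a function \<open>a\<close> with \<open>m * P a \<ge> (1 + \<delta>) * a\<close> for the walk
  killed outside the pattern: a \<open>d\<close>-ary tree if \<open>m * \<rho> > 1\<close>, and a trap (many children above, \<open>d\<close> children below) if
  \<open>d < lam\<close> and some degree exceeds \<open>lam\<close>. A bound \<open>q \<le> 1 - \<epsilon> * a\<close> on a copy of the pattern improves itself up to a
  universal \<open>\<epsilon>\<close>, and for almost every tree the walk from any vertex hits a copy, because each time it reaches a new
  level the tree below is fresh. As \<open>q\<close> is subharmonic, \<open>sup q < 1\<close>. If no degree exceeds \<open>lam\<close>, the walk itself is
  recurrent.\<close>

section \<open>Products of discrete distributions\<close>

lemma prob_space_PiM_pmf: "prob_space (PiM UNIV (\<lambda>i. measure_pmf (P i)))"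
  by (intro prob_space_PiM measure_pmf.prob_space_axioms)

lemma space_PiM_pmf [simp]: "space (PiM UNIV (\<lambda>i. measure_pmf (P i))) = UNIV"
  by (simp add: space_PiM)

lemma measurable_PiM_pmf_component [measurable]:
  "(\<lambda>\<omega>. \<omega> i) \<in> PiM UNIV (\<lambda>i. measure_pmf (P i)) \<rightarrow>\<^sub>M count_space UNIV"
proof -
  have "(\<lambda>\<omega>. \<omega> i) \<in> PiM UNIV (\<lambda>i. measure_pmf (P i)) \<rightarrow>\<^sub>M measure_pmf (P i)"
    by (rule measurable_component_singleton) simp
  then show ?thesis by simp
qed

lemma distr_PiM_pmf_component:
  "distr (PiM UNIV (\<lambda>i. measure_pmf (P i))) (measure_pmf (P i)) (\<lambda>\<omega>. \<omega> i) = measure_pmf (P i)"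
  by (intro distr_PiM_component measure_pmf.prob_space_axioms) simp

lemma nn_integral_PiM_pmf_component:
  "(\<integral>\<^sup>+\<omega>. f (\<omega> i) \<partial>PiM UNIV (\<lambda>i. measure_pmf (P i))) = (\<integral>\<^sup>+a. f a \<partial>measure_pmf (P i))"
proof -
  have "(\<integral>\<^sup>+a. f a \<partial>measure_pmf (P i)) =
      (\<integral>\<^sup>+a. f a \<partial>distr (PiM UNIV (\<lambda>i. measure_pmf (P i))) (measure_pmf (P i)) (\<lambda>\<omega>. \<omega> i))"
    by (simp only: distr_PiM_pmf_component)
  also have "\<dots> = (\<integral>\<^sup>+\<omega>. f (\<omega> i) \<partial>PiM UNIV (\<lambda>i. measure_pmf (P i)))"
    by (intro nn_integral_distr measurable_component_singleton) auto
  finally show ?thesis ..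
qed

text \<open>Passing to the coordinates below a child is the relabelling
  \<open>u \<mapsto> i # u\<close>; this lemma is what makes the subtree of a child a copy of the
  whole family.\<close>

lemma nn_integral_PiM_pmf_reindex:
  assumes f: "inj f" and g: "g \<in> borel_measurable (PiM UNIV (\<lambda>i. measure_pmf (P (f i))))"
  shows "(\<integral>\<^sup>+\<omega>. g (\<lambda>i. \<omega> (f i)) \<partial>PiM UNIV (\<lambda>i. measure_pmf (P i))) =
    (\<integral>\<^sup>+\<omega>. g \<omega> \<partial>PiM UNIV (\<lambda>i. measure_pmf (P (f i))))"
proof -
  have eq: "distr (PiM UNIV (\<lambda>i. measure_pmf (P i))) (PiM UNIV (\<lambda>i. measure_pmf (P (f i))))
      (\<lambda>\<omega>. \<lambda>n\<in>UNIV. \<omega> (f n)) = PiM UNIV (\<lambda>i. measure_pmf (P (f i)))"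
    by (rule distr_PiM_reindex) (auto simp: f intro: measure_pmf.prob_space_axioms)
  have "(\<integral>\<^sup>+\<omega>. g \<omega> \<partial>PiM UNIV (\<lambda>i. measure_pmf (P (f i)))) =
    (\<integral>\<^sup>+\<omega>. g \<omega> \<partial>distr (PiM UNIV (\<lambda>i. measure_pmf (P i))) (PiM UNIV (\<lambda>i. measure_pmf (P (f i))))
      (\<lambda>\<omega>. \<lambda>n\<in>UNIV. \<omega> (f n)))"
    by (simp only: eq)
  also have "\<dots> = (\<integral>\<^sup>+\<omega>. g (\<lambda>n\<in>UNIV. \<omega> (f n)) \<partial>PiM UNIV (\<lambda>i. measure_pmf (P i)))"
    by (rule nn_integral_distr) (use g in \<open>auto intro!: measurable_restrict\<close>)
  finally show ?thesis by (simp add: restrict_UNIV)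
qed

text \<open>Independence of disjoint coordinate blocks. Dependence on a block is expressed pointwise
  by \<open>dep\<close>, so that it can be checked by congruence lemmas and no sub-sigma-algebras
  appear later.\<close>

lemma nn_integral_prod_PiM_pmf:
  fixes f :: "'k \<Rightarrow> ('i \<Rightarrow> 'a) \<Rightarrow> ennreal" and P :: "'i \<Rightarrow> 'a pmf"
  assumes fin: "finite F" and disj: "disjoint_family_on B F"
    and meas: "\<And>k. k \<in> F \<Longrightarrow> f k \<in> borel_measurable (PiM UNIV (\<lambda>i. measure_pmf (P i)))"
    and dep: "\<And>k \<omega> \<omega>'. k \<in> F \<Longrightarrow> (\<And>i. i \<in> B k \<Longrightarrow> \<omega> i = \<omega>' i) \<Longrightarrow> f k \<omega> = f k \<omega>'"
  shows "(\<integral>\<^sup>+\<omega>. (\<Prod>k\<in>F. f k \<omega>) \<partial>PiM UNIV (\<lambda>i. measure_pmf (P i))) =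
    (\<Prod>k\<in>F. \<integral>\<^sup>+\<omega>. f k \<omega> \<partial>PiM UNIV (\<lambda>i. measure_pmf (P i)))"
proof -
  let ?M = "\<lambda>i. measure_pmf (P i)"
  interpret prob_space "PiM UNIV ?M" by (rule prob_space_PiM_pmf)
  have X: "random_variable (?M i) (\<lambda>\<omega>. \<omega> i)" for i
    by (rule measurable_component_singleton) simp
  have "indep_vars ?M (\<lambda>i \<omega>. \<omega> i) UNIV"
    by (subst indep_vars_iff_distr_eq_PiM[OF _ X]) (simp_all add: distr_PiM_pmf_component restrict_UNIV)
  from indep_vars_restrict[OF this _ disj]
  have "indep_vars (\<lambda>j. PiM (B j) ?M) (\<lambda>j \<omega>. restrict (\<lambda>i. \<omega> i) (B j)) F" by simp
  then have ind: "indep_vars (\<lambda>_. borel) (\<lambda>k \<omega>. f k (restrict \<omega> (B k))) F"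
  proof (rule indep_vars_compose2)
    fix k assume k: "k \<in> F"
    \<comment> \<open>Points of the partial product are functions equal to \<open>undefined\<close>
      off \<open>B k\<close>, so each coordinate of the inclusion is either a projection or a
      constant.\<close>
    have "(\<lambda>\<omega>. \<omega>) \<in> PiM (B k) ?M \<rightarrow>\<^sub>M PiM UNIV ?M"
    proof (rule measurable_PiM_single'[where f = "\<lambda>i \<omega>. \<omega> i"])
      fix i
      have "(\<lambda>\<omega>. \<omega> i) \<in> PiM (B k) ?M \<rightarrow>\<^sub>M count_space UNIV"
      proof (cases "i \<in> B k")
        case True
        from measurable_component_singleton[OF this, of ?M] show ?thesis by simp
      next
        case False
        then have "(\<lambda>\<omega>. \<omega> i) \<in> PiM (B k) ?M \<rightarrow>\<^sub>M count_space UNIV \<longleftrightarrow>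
          (\<lambda>\<omega>. undefined) \<in> PiM (B k) ?M \<rightarrow>\<^sub>M count_space (UNIV :: 'a set)"
          by (intro measurable_cong) (auto simp: space_PiM PiE_def extensional_def)
        then show ?thesis by simp
      qed
      then show "(\<lambda>\<omega>. \<omega> i) \<in> PiM (B k) ?M \<rightarrow>\<^sub>M ?M i" by simp
    qed simp
    then show "f k \<in> borel_measurable (PiM (B k) ?M)"
      using measurable_compose meas[OF k] by blast
  qed
  have eq: "f k (restrict \<omega> (B k)) = f k \<omega>" if "k \<in> F" for k \<omega>
    by (rule dep[OF that]) simp
  have "(\<integral>\<^sup>+\<omega>. (\<Prod>k\<in>F. f k (restrict \<omega> (B k))) \<partial>PiM UNIV ?M) =
    (\<Prod>k\<in>F. \<integral>\<^sup>+\<omega>. f k (restrict \<omega> (B k)) \<partial>PiM UNIV ?M)"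
    by (rule indep_vars_nn_integral[OF fin ind]) simp
  then show ?thesis by (simp add: eq cong: prod.cong)
qed

lemma nn_integral_mult_PiM_pmf:
  fixes f g :: "('i \<Rightarrow> 'a) \<Rightarrow> ennreal" and P :: "'i \<Rightarrow> 'a pmf"
  assumes f: "f \<in> borel_measurable (PiM UNIV (\<lambda>i. measure_pmf (P i)))"
    and g: "g \<in> borel_measurable (PiM UNIV (\<lambda>i. measure_pmf (P i)))"
    and "A \<inter> B = {}"
    and "\<And>\<omega> \<omega>'. (\<And>i. i \<in> A \<Longrightarrow> \<omega> i = \<omega>' i) \<Longrightarrow> f \<omega> = f \<omega>'"
    and "\<And>\<omega> \<omega>'. (\<And>i. i \<in> B \<Longrightarrow> \<omega> i = \<omega>' i) \<Longrightarrow> g \<omega> = g \<omega>'"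
  shows "(\<integral>\<^sup>+\<omega>. f \<omega> * g \<omega> \<partial>PiM UNIV (\<lambda>i. measure_pmf (P i))) =
    (\<integral>\<^sup>+\<omega>. f \<omega> \<partial>PiM UNIV (\<lambda>i. measure_pmf (P i))) * (\<integral>\<^sup>+\<omega>. g \<omega> \<partial>PiM UNIV (\<lambda>i. measure_pmf (P i)))"
proof -
  have "(\<integral>\<^sup>+\<omega>. (\<Prod>b\<in>UNIV. (if b then f else g) \<omega>) \<partial>PiM UNIV (\<lambda>i. measure_pmf (P i))) =
    (\<Prod>b\<in>UNIV. \<integral>\<^sup>+\<omega>. (if b then f else g) \<omega> \<partial>PiM UNIV (\<lambda>i. measure_pmf (P i)))"
  proof (rule nn_integral_prod_PiM_pmf[where B = "\<lambda>b. if b then A else B"])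
    show "disjoint_family_on (\<lambda>b. if b then A else B) UNIV"
      using assms(3) by (auto simp: disjoint_family_on_def)
    show "(if b then f else g) \<in> borel_measurable (PiM UNIV (\<lambda>i. measure_pmf (P i)))" for b
      using f g by simp
    show "(if b then f else g) \<omega> = (if b then f else g) \<omega>'"
      if "\<And>i. i \<in> (if b then A else B) \<Longrightarrow> \<omega> i = \<omega>' i" for b \<omega> \<omega>'
      using that assms(4,5)[of \<omega> \<omega>'] by (cases b) simp_all
  qed simp
  then show ?thesis by (simp add: UNIV_bool mult.commute)
qed

text \<open>Expectations under a discrete law become countable sums, which reduces measurability in
  the environment to measurability of each term.\<close>

lemma borel_measurable_nn_integral_count_space:
  fixes f :: "'b::countable \<Rightarrow> 'a \<Rightarrow> ennreal"
  assumes "\<And>x. f x \<in> borel_measurable M"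
  shows "(\<lambda>\<omega>. \<integral>\<^sup>+x. f x \<omega> \<partial>count_space UNIV) \<in> borel_measurable M"
proof -
  interpret sigma_finite_measure "count_space (UNIV :: 'b set)"
    by (rule sigma_finite_measure_count_space)
  have "(\<lambda>p. f (snd p) (fst p)) \<in> borel_measurable (M \<Otimes>\<^sub>M count_space UNIV)"
    by (rule measurable_compose_countable[where f = "\<lambda>x p. f x (fst p)" and g = snd])
       (use assms in measurable)
  then show ?thesis
    by (intro borel_measurable_nn_integral) (simp add: case_prod_unfold)
qed

section \<open>The branching property\<close>

lemma brw_pos_Nil [simp]: "brw_pos \<xi> y [] = y"
  by (simp add: brw_pos_def)

lemma brw_pos_snoc [simp]: "brw_pos \<xi> y (u @ [j]) = \<xi> (u @ [j], brw_pos \<xi> y u)"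
  by (simp add: brw_pos_def)

text \<open>\<open>brw_pos\<close> recurses on the last letter, that is, on the parent. Splitting
  off the first letter instead exhibits the descendants of child \<open>i\<close> as a branching
  walk started at the position of that child.\<close>

lemma brw_pos_Cons:
  "brw_pos \<xi> y (i # u) = brw_pos (\<lambda>(v, z). \<xi> (i # v, z)) (\<xi> ([i], y)) u"
proof (induction u rule: rev_induct)
  case Nil
  show ?case using brw_pos_snoc[of \<xi> y "[]" i] by simp
next
  case (snoc j u)
  show ?case using brw_pos_snoc[of \<xi> y "i # u" j] snoc by simp
qed

text \<open>The displacement of the ancestor is never read. Hence, after a shift to child
  \<open>i\<close>, the family below it does not look at the displacements of \<open>[i]\<close>
  itself, which only determine its starting point.\<close>

lemma brw_pos_cong:
  assumes "\<And>v z. v \<noteq> [] \<Longrightarrow> \<xi> (v, z) = \<xi>' (v, z)"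
  shows "brw_pos \<xi> y u = brw_pos \<xi>' y u"
  by (induction u rule: rev_induct) (simp_all add: assms)

lemma in_tree_Nil [simp]: "in_tree \<nu> []"
  by (simp add: in_tree_def)

lemma in_tree_Cons: "in_tree \<nu> (i # u) \<longleftrightarrow> i < \<nu> [] \<and> in_tree (\<lambda>v. \<nu> (i # v)) u"
  by (auto simp: in_tree_def All_less_Suc2)

text \<open>The set \<open>I\<close> of generations serves three purposes: \<open>UNIV\<close> for
  never hitting \<open>x\<close>, \<open>{n..}\<close> for no visit from generation \<open>n\<close>
  on, and \<open>{N}\<close> for a single generation.\<close>

definition avoids :: "nat set \<Rightarrow> nat list \<Rightarrow> (nat list \<Rightarrow> nat) \<Rightarrow>
    (nat list \<times> nat list \<Rightarrow> nat list) \<Rightarrow> nat list \<Rightarrow> bool" where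
  "avoids I x \<nu> \<xi> y \<longleftrightarrow> (\<forall>u. in_tree \<nu> u \<longrightarrow> length u \<in> I \<longrightarrow> brw_pos \<xi> y u \<noteq> x)"

lemma avoids_branch:
  assumes "0 \<notin> I"
  shows "avoids I x \<nu> \<xi> y \<longleftrightarrow>
    (\<forall>i<\<nu> []. avoids {n. Suc n \<in> I} x (\<lambda>u. \<nu> (i # u)) (\<lambda>(u, z). \<xi> (i # u, z)) (\<xi> ([i], y)))"
    (is "?L \<longleftrightarrow> ?R")
proof
  assume L: ?L
  show ?R
    unfolding avoids_def
  proof (intro allI impI)
    fix i u
    assume "i < \<nu> []" "in_tree (\<lambda>u. \<nu> (i # u)) u" "length u \<in> {n. Suc n \<in> I}"
    then have "brw_pos \<xi> y (i # u) \<noteq> x"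
      using L unfolding avoids_def by (auto simp: in_tree_Cons)
    then show "brw_pos (\<lambda>(u, z). \<xi> (i # u, z)) (\<xi> ([i], y)) u \<noteq> x"
      by (simp add: brw_pos_Cons)
  qed
next
  assume R: ?R
  show ?L
    unfolding avoids_def
  proof (intro allI impI)
    fix w assume w: "in_tree \<nu> w" "length w \<in> I"
    with assms obtain i u where [simp]: "w = i # u" by (cases w) auto
    show "brw_pos \<xi> y w \<noteq> x"
      using R w by (auto simp: in_tree_Cons brw_pos_Cons avoids_def)
  qed
qed

lemma avoids_cong:
  assumes "\<And>v z. v \<noteq> [] \<Longrightarrow> \<xi> (v, z) = \<xi>' (v, z)"
  shows "avoids I x \<nu> \<xi> y \<longleftrightarrow> avoids I x \<nu> \<xi>' y"
  using brw_pos_cong[of \<xi> \<xi>' y, OF assms] by (simp add: avoids_def)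

section \<open>Measurability and independence of genealogy and displacements\<close>

abbreviation genealogies :: "nat pmf \<Rightarrow> (nat list \<Rightarrow> nat) measure" where
  "genealogies \<mu> \<equiv> PiM UNIV (\<lambda>_. measure_pmf \<mu>)"

abbreviation displacements ::
    "(nat list \<Rightarrow> nat list pmf) \<Rightarrow> (nat list \<times> nat list \<Rightarrow> nat list) measure" where
  "displacements K \<equiv> PiM UNIV (\<lambda>i. measure_pmf (K (snd i)))"

lemma brw_space_eq: "brw_space \<kappa> lam \<mu> = genealogies \<mu> \<Otimes>\<^sub>M displacements (lb_step \<kappa> lam)"
  unfolding brw_space_def by (simp add: case_prod_unfold)

lemma measurable_in_tree [measurable]:
  "Measurable.pred (genealogies \<mu>) (\<lambda>\<nu>. in_tree \<nu> u)"
  unfolding in_tree_def by measurable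

lemma measurable_brw_pos [measurable]:
  "(\<lambda>\<xi>. brw_pos \<xi> y u) \<in> displacements K \<rightarrow>\<^sub>M count_space UNIV"
proof (induction u rule: rev_induct)
  case (snoc j u)
  have "(\<lambda>\<xi>. \<xi> (u @ [j], brw_pos \<xi> y u)) \<in> displacements K \<rightarrow>\<^sub>M count_space UNIV"
    by (rule measurable_compose_countable[OF _ snoc, where f = "\<lambda>z \<xi>. \<xi> (u @ [j], z)"])
       (rule measurable_PiM_pmf_component)
  then show ?case by simp
qed simp

lemma measurable_avoids [measurable]:
  "Measurable.pred (genealogies \<mu> \<Otimes>\<^sub>M displacements K) (\<lambda>(\<nu>, \<xi>). avoids I x \<nu> \<xi> y)"
proof -
  have [measurable]: "Measurable.pred (genealogies \<mu> \<Otimes>\<^sub>M displacements K) (\<lambda>\<omega>. in_tree (fst \<omega>) u)" for u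
    by measurable
  have [measurable]: "(\<lambda>\<omega>. brw_pos (snd \<omega>) y u) \<in> genealogies \<mu> \<Otimes>\<^sub>M displacements K \<rightarrow>\<^sub>M count_space UNIV" for u
    by (rule measurable_compose[OF measurable_snd measurable_brw_pos])
  show ?thesis
    unfolding avoids_def case_prod_unfold by measurable
qed

lemma measurable_avoids_displacements [measurable]:
  "Measurable.pred (displacements K) (\<lambda>\<xi>. avoids I x \<nu> \<xi> y)"
  unfolding avoids_def by measurable

lemma indicator_All_less: "indicator {\<omega>. \<forall>i<n::nat. P i \<omega>} \<omega> = (\<Prod>i<n. indicator {\<omega>. P i \<omega>} \<omega> :: ennreal)"
  by (induction n) (auto simp: indicator_def less_Suc_eq)

text \<open>For a fixed genealogy the families of different children read disjoint displacements,
  which gives the product; in each factor, the position of the child is independent of the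
  displacements below it.\<close>

lemma nn_integral_displacements_branch:
  fixes K :: "nat list \<Rightarrow> nat list pmf" and x y :: "nat list"
  assumes I: "0 \<notin> I"
  defines "R \<equiv> (\<lambda>\<nu> z. \<integral>\<^sup>+\<xi>. indicator {\<xi>. avoids {n. Suc n \<in> I} x \<nu> \<xi> z} \<xi> \<partial>displacements K)"
  shows "(\<integral>\<^sup>+\<xi>. indicator {\<xi>. avoids I x \<nu> \<xi> y} \<xi> \<partial>displacements K) =
    (\<Prod>i<\<nu> []. \<integral>\<^sup>+z. R (\<lambda>u. \<nu> (i # u)) z \<partial>measure_pmf (K y))"
proof -
  let ?I = "{n. Suc n \<in> I}"
  let ?D = "displacements K"
  let ?s = "\<lambda>i \<xi>. (\<lambda>(u, z). \<xi> (i # u, z))"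
  have shift: "?s i \<in> ?D \<rightarrow>\<^sub>M ?D" for i
    unfolding case_prod_unfold by (rule measurable_PiM_single') auto
  have pred1 [measurable]: "Measurable.pred ?D (\<lambda>\<xi>. avoids ?I x \<nu>' (?s i \<xi>) z)" for \<nu>' i z
    by (rule measurable_compose[OF shift measurable_avoids_displacements])
  have pred2 [measurable]: "Measurable.pred ?D (\<lambda>\<xi>. avoids ?I x \<nu>' (?s i \<xi>) (\<xi> ([i], y)))" for \<nu>' i
    by (rule measurable_compose_countable[where f = "\<lambda>z \<xi>. avoids ?I x \<nu>' (?s i \<xi>) z"]) measurable
  have one: "(\<integral>\<^sup>+\<xi>. indicator {\<xi>. avoids ?I x \<nu>' (?s i \<xi>) (\<xi> ([i], y))} \<xi> \<partial>?D) =
      (\<integral>\<^sup>+z. R \<nu>' z \<partial>measure_pmf (K y))" for \<nu>' i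
  proof -
    let ?a = "\<lambda>z \<xi>. indicator {\<xi>. \<xi> ([i], y) = z} \<xi> :: ennreal"
    let ?b = "\<lambda>z \<xi>. indicator {\<xi>. avoids ?I x \<nu>' (?s i \<xi>) z} \<xi> :: ennreal"
    have [measurable]: "?a z \<in> borel_measurable ?D" "?b z \<in> borel_measurable ?D" for z
      by measurable
    \<comment> \<open>Decompose according to the position \<open>z\<close> of the child, so that the
      random index disappears.\<close>
    have "indicator {\<xi>. avoids ?I x \<nu>' (?s i \<xi>) (\<xi> ([i], y))} \<xi> =
        (\<integral>\<^sup>+z. ?a z \<xi> * ?b z \<xi> \<partial>count_space UNIV)" for \<xi>
      by (subst nn_integral_count_space'[where A = "{\<xi> ([i], y)}"]) (auto simp: indicator_def)
    then have "(\<integral>\<^sup>+\<xi>. indicator {\<xi>. avoids ?I x \<nu>' (?s i \<xi>) (\<xi> ([i], y))} \<xi> \<partial>?D) =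
        (\<integral>\<^sup>+\<xi>. \<integral>\<^sup>+z. ?a z \<xi> * ?b z \<xi> \<partial>count_space UNIV \<partial>?D)" by simp
    also have "\<dots> = (\<integral>\<^sup>+z. \<integral>\<^sup>+\<xi>. ?a z \<xi> * ?b z \<xi> \<partial>?D \<partial>count_space UNIV)"
      by (rule nn_integral_count_space_nn_integral) auto
    also have "\<dots> = (\<integral>\<^sup>+z. pmf (K y) z * R \<nu>' z \<partial>count_space UNIV)"
    proof (rule nn_integral_cong)
      fix z
      have "(\<integral>\<^sup>+\<xi>. ?a z \<xi> * ?b z \<xi> \<partial>?D) = (\<integral>\<^sup>+\<xi>. ?a z \<xi> \<partial>?D) * (\<integral>\<^sup>+\<xi>. ?b z \<xi> \<partial>?D)"
      proof (rule nn_integral_mult_PiM_pmf[where A = "{([i], y)}" and B = "{(i # u, w) | u w. u \<noteq> []}"])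
        fix \<xi> \<xi>' :: "nat list \<times> nat list \<Rightarrow> nat list"
        assume "\<And>j. j \<in> {(i # u, w) | u w. u \<noteq> []} \<Longrightarrow> \<xi> j = \<xi>' j"
        then have "avoids ?I x \<nu>' (?s i \<xi>) z \<longleftrightarrow> avoids ?I x \<nu>' (?s i \<xi>') z"
          by (intro avoids_cong) auto
        then show "?b z \<xi> = ?b z \<xi>'" by (simp add: indicator_def)
      qed (auto simp: indicator_def)
      also have "(\<integral>\<^sup>+\<xi>. ?a z \<xi> \<partial>?D) = (\<integral>\<^sup>+\<xi>. indicator {z} (\<xi> ([i], y)) \<partial>?D)"
        by (intro nn_integral_cong) (auto simp: indicator_def)
      also have "\<dots> = pmf (K y) z"
        by (subst nn_integral_PiM_pmf_component) (simp add: emeasure_pmf_single)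
      also have "(\<integral>\<^sup>+\<xi>. ?b z \<xi> \<partial>?D) =
          (\<integral>\<^sup>+\<xi>. indicator {\<xi>. avoids ?I x \<nu>' \<xi> z} (\<lambda>j. \<xi> (i # fst j, snd j)) \<partial>?D)"
        by (simp add: indicator_def case_prod_unfold)
      also have "\<dots> = R \<nu>' z"
        using nn_integral_PiM_pmf_reindex[where P = "\<lambda>j. K (snd j)" and f = "\<lambda>j. (i # fst j, snd j)"
            and g = "indicator {\<xi>. avoids ?I x \<nu>' \<xi> z}"]
        by (simp add: inj_def prod_eq_iff R_def)
      finally show "(\<integral>\<^sup>+\<xi>. ?a z \<xi> * ?b z \<xi> \<partial>?D) = pmf (K y) z * R \<nu>' z" .
    qed
    also have "\<dots> = (\<integral>\<^sup>+z. R \<nu>' z \<partial>measure_pmf (K y))"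
      by (rule nn_integral_measure_pmf[symmetric])
    finally show ?thesis .
  qed
  have "(\<integral>\<^sup>+\<xi>. indicator {\<xi>. avoids I x \<nu> \<xi> y} \<xi> \<partial>?D) =
    (\<integral>\<^sup>+\<xi>. (\<Prod>i<\<nu> []. indicator {\<xi>. avoids ?I x (\<lambda>u. \<nu> (i # u)) (?s i \<xi>) (\<xi> ([i], y))} \<xi>) \<partial>?D)"
    unfolding avoids_branch[OF I] indicator_All_less ..
  also have "\<dots> = (\<Prod>i<\<nu> []. \<integral>\<^sup>+\<xi>. indicator {\<xi>. avoids ?I x (\<lambda>u. \<nu> (i # u)) (?s i \<xi>) (\<xi> ([i], y))} \<xi> \<partial>?D)"
  proof (rule nn_integral_prod_PiM_pmf[where B = "\<lambda>i. {(i # u, w) | u w. True}"])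
    fix i and \<xi> \<xi>' :: "nat list \<times> nat list \<Rightarrow> nat list"
    assume *: "\<And>j. j \<in> {(i # u, w) | u w. True} \<Longrightarrow> \<xi> j = \<xi>' j"
    then have "?s i \<xi> = ?s i \<xi>'" "\<xi> ([i], y) = \<xi>' ([i], y)" by auto
    then show "indicator {\<xi>. avoids ?I x (\<lambda>u. \<nu> (i # u)) (?s i \<xi>) (\<xi> ([i], y))} \<xi> =
      (indicator {\<xi>. avoids ?I x (\<lambda>u. \<nu> (i # u)) (?s i \<xi>) (\<xi> ([i], y))} \<xi>' :: ennreal)"
      by (simp add: indicator_def)
  qed (auto simp: disjoint_family_on_def)
  finally show ?thesis by (simp add: one)
qed

section \<open>The recursion for avoidance probabilities\<close>

definition avoid_prob :: "(nat list \<Rightarrow> nat) \<Rightarrow> real \<Rightarrow> nat pmf \<Rightarrow> nat set \<Rightarrow> nat list \<Rightarrow> nat list \<Rightarrow> real" where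
  "avoid_prob \<kappa> lam \<mu> I x y = measure (brw_space \<kappa> lam \<mu>) {(\<nu>, \<xi>). avoids I x \<nu> \<xi> y}"

lemma prob_space_brw_space: "prob_space (brw_space \<kappa> lam \<mu>)"
  unfolding brw_space_eq by (intro prob_space_pair prob_space_PiM_pmf)

lemma space_brw_space [simp]: "space (brw_space \<kappa> lam \<mu>) = UNIV"
  unfolding brw_space_eq by (simp add: space_pair_measure)

lemma sets_avoids [measurable]: "{(\<nu>, \<xi>). avoids I x \<nu> \<xi> y} \<in> sets (brw_space \<kappa> lam \<mu>)"
  using measurable_avoids[where \<mu> = \<mu> and K = "lb_step \<kappa> lam" and I = I and x = x and y = y]
  unfolding pred_def brw_space_eq by (simp add: space_pair_measure)

lemma avoid_prob_nonneg [simp]: "0 \<le> avoid_prob \<kappa> lam \<mu> I x y"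
  by (simp add: avoid_prob_def)

lemma avoid_prob_le_1 [simp]: "avoid_prob \<kappa> lam \<mu> I x y \<le> 1"
  unfolding avoid_prob_def by (rule prob_space.prob_le_1[OF prob_space_brw_space])

lemma ennreal_avoid_prob:
  "ennreal (avoid_prob \<kappa> lam \<mu> I x y) =
    (\<integral>\<^sup>+\<nu>. \<integral>\<^sup>+\<xi>. indicator {\<xi>. avoids I x \<nu> \<xi> y} \<xi> \<partial>displacements (lb_step \<kappa> lam) \<partial>genealogies \<mu>)"
proof -
  interpret N: prob_space "genealogies \<mu>" by (rule prob_space_PiM_pmf)
  interpret D: prob_space "displacements (lb_step \<kappa> lam)" by (rule prob_space_PiM_pmf)
  interpret B: prob_space "brw_space \<kappa> lam \<mu>" by (rule prob_space_brw_space)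
  have "ennreal (avoid_prob \<kappa> lam \<mu> I x y) = emeasure (brw_space \<kappa> lam \<mu>) {(\<nu>, \<xi>). avoids I x \<nu> \<xi> y}"
    unfolding avoid_prob_def by (rule B.emeasure_eq_measure[symmetric])
  also have "\<dots> = (\<integral>\<^sup>+\<nu>. \<integral>\<^sup>+\<xi>. indicator {(\<nu>, \<xi>). avoids I x \<nu> \<xi> y} (\<nu>, \<xi>)
      \<partial>displacements (lb_step \<kappa> lam) \<partial>genealogies \<mu>)"
    using sets_avoids[of I x y \<kappa> lam \<mu>] unfolding brw_space_eq by (rule D.emeasure_pair_measure)
  finally show ?thesis by (simp add: indicator_def)
qed

lemma measurable_displacements_integral [measurable]:
  "(\<lambda>\<nu>. \<integral>\<^sup>+\<xi>. indicator {\<xi>. avoids I x \<nu> \<xi> z} \<xi> \<partial>displacements K) \<in> borel_measurable (genealogies \<mu>)"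
proof -
  interpret D: prob_space "displacements K" by (rule prob_space_PiM_pmf)
  have "{\<omega> \<in> space (genealogies \<mu> \<Otimes>\<^sub>M displacements K). avoids I x (fst \<omega>) (snd \<omega>) z}
      \<in> sets (genealogies \<mu> \<Otimes>\<^sub>M displacements K)"
    using measurable_avoids[where \<mu> = \<mu> and K = K and I = I and x = x and y = z] by (simp add: pred_def case_prod_unfold)
  then have "(\<lambda>(\<nu>, \<xi>). indicator {\<xi>. avoids I x \<nu> \<xi> z} \<xi> :: ennreal)
      \<in> borel_measurable (genealogies \<mu> \<Otimes>\<^sub>M displacements K)"
    by (subst measurable_cong[where g = "indicator {\<omega>. avoids I x (fst \<omega>) (snd \<omega>) z}"])
       (auto simp: indicator_def space_pair_measure)
  then show ?thesis by (rule D.borel_measurable_nn_integral)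
qed

text \<open>Given \<open>n\<close> children of the ancestor, their families are independent copies
  of the whole process, each started after one step from \<open>y\<close>. As generation 0 does not
  count, all \<open>n\<close> must avoid \<open>x\<close> with generations shifted by one.\<close>

lemma avoid_prob_branch:
  assumes I: "0 \<notin> I"
  shows "avoid_prob \<kappa> lam \<mu> I x y = measure_pmf.expectation \<mu>
    (\<lambda>n. (measure_pmf.expectation (lb_step \<kappa> lam y) (avoid_prob \<kappa> lam \<mu> {n. Suc n \<in> I} x)) ^ n)"
proof -
  let ?K = "lb_step \<kappa> lam" and ?I = "{n. Suc n \<in> I}" and ?N = "genealogies \<mu>"
  define R where "R = (\<lambda>\<nu> z. \<integral>\<^sup>+\<xi>. indicator {\<xi>. avoids ?I x \<nu> \<xi> z} \<xi> \<partial>displacements ?K)"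
  define h where "h = (\<lambda>\<nu>. \<integral>\<^sup>+z. R \<nu> z \<partial>measure_pmf (?K y))"
  define Q where "Q = measure_pmf.expectation (?K y) (avoid_prob \<kappa> lam \<mu> ?I x)"
  have R [measurable]: "(\<lambda>\<nu>. R \<nu> z) \<in> borel_measurable ?N" for z
    unfolding R_def by measurable
  have h [measurable]: "h \<in> borel_measurable ?N"
    unfolding h_def nn_integral_measure_pmf by (rule borel_measurable_nn_integral_count_space) measurable
  have Q0: "0 \<le> Q" unfolding Q_def by (rule integral_nonneg_AE) simp
  have Q1: "Q \<le> 1" unfolding Q_def
    by (rule measure_pmf.integral_le_const[OF measure_pmf.integrable_const_bound[where B = 1]]) auto
  have int_h: "(\<integral>\<^sup>+\<nu>. h \<nu> \<partial>?N) = ennreal Q"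
  proof -
    have "(\<integral>\<^sup>+\<nu>. h \<nu> \<partial>?N) = (\<integral>\<^sup>+\<nu>. \<integral>\<^sup>+z. pmf (?K y) z * R \<nu> z \<partial>count_space UNIV \<partial>?N)"
      unfolding h_def nn_integral_measure_pmf ..
    also have "\<dots> = (\<integral>\<^sup>+z. \<integral>\<^sup>+\<nu>. pmf (?K y) z * R \<nu> z \<partial>?N \<partial>count_space UNIV)"
      by (rule nn_integral_count_space_nn_integral) auto
    also have "\<dots> = (\<integral>\<^sup>+z. pmf (?K y) z * ennreal (avoid_prob \<kappa> lam \<mu> ?I x z) \<partial>count_space UNIV)"
      by (simp add: nn_integral_cmult) (simp add: ennreal_avoid_prob R_def)
    also have "\<dots> = (\<integral>\<^sup>+z. ennreal (avoid_prob \<kappa> lam \<mu> ?I x z) \<partial>measure_pmf (?K y))"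
      by (rule nn_integral_measure_pmf[symmetric])
    also have "\<dots> = ennreal Q" unfolding Q_def
      by (rule nn_integral_eq_integral[OF measure_pmf.integrable_const_bound[where B = 1]]) auto
    finally show ?thesis .
  qed
  have shift: "(\<lambda>\<nu> u. \<nu> (i # u)) \<in> ?N \<rightarrow>\<^sub>M ?N" for i
    by (rule measurable_PiM_single') auto
  have hs [measurable]: "(\<lambda>\<nu>. h (\<lambda>u. \<nu> (i # u))) \<in> borel_measurable ?N" for i
    by (rule measurable_compose[OF shift h])
  have int_hs: "(\<integral>\<^sup>+\<nu>. h (\<lambda>u. \<nu> (i # u)) \<partial>?N) = ennreal Q" for i
    using nn_integral_PiM_pmf_reindex[of "(#) i" h "\<lambda>_. \<mu>"] h by (simp add: int_h)
  \<comment> \<open>The offspring number of the ancestor and the genealogies of its first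
    \<open>n\<close> children use disjoint coordinates.\<close>
  have fixed: "(\<integral>\<^sup>+\<nu>. indicator {\<nu>. \<nu> [] = n} \<nu> * (\<Prod>i<n. h (\<lambda>u. \<nu> (i # u))) \<partial>?N) =
      pmf \<mu> n * ennreal (Q ^ n)" for n
  proof -
    have "(\<integral>\<^sup>+\<nu>. indicator {\<nu>. \<nu> [] = n} \<nu> * (\<Prod>i<n. h (\<lambda>u. \<nu> (i # u))) \<partial>?N) =
      (\<integral>\<^sup>+\<nu>. indicator {\<nu>. \<nu> [] = n} \<nu> \<partial>?N) * (\<integral>\<^sup>+\<nu>. (\<Prod>i<n. h (\<lambda>u. \<nu> (i # u))) \<partial>?N)"
    proof (rule nn_integral_mult_PiM_pmf[where A = "{[]}" and B = "- {[]}"])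
      fix \<nu> \<nu>' :: "nat list \<Rightarrow> nat" assume "\<And>i. i \<in> - {[]} \<Longrightarrow> \<nu> i = \<nu>' i"
      then show "(\<Prod>i<n. h (\<lambda>u. \<nu> (i # u))) = (\<Prod>i<n. h (\<lambda>u. \<nu>' (i # u)))" by simp
    qed (auto simp: indicator_def)
    also have "(\<integral>\<^sup>+\<nu>. indicator {\<nu>. \<nu> [] = n} \<nu> \<partial>?N) = (\<integral>\<^sup>+\<nu>. indicator {n} (\<nu> []) \<partial>?N)"
      by (intro nn_integral_cong) (auto simp: indicator_def)
    also have "\<dots> = pmf \<mu> n"
      by (subst nn_integral_PiM_pmf_component) (simp add: emeasure_pmf_single)
    also have "(\<integral>\<^sup>+\<nu>. (\<Prod>i<n. h (\<lambda>u. \<nu> (i # u))) \<partial>?N) = (\<Prod>i<n. \<integral>\<^sup>+\<nu>. h (\<lambda>u. \<nu> (i # u)) \<partial>?N)"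
    proof (rule nn_integral_prod_PiM_pmf[where B = "\<lambda>i. range ((#) i)"])
      fix i and \<nu> \<nu>' :: "nat list \<Rightarrow> nat" assume "\<And>j. j \<in> range ((#) i) \<Longrightarrow> \<nu> j = \<nu>' j"
      then have "(\<lambda>u. \<nu> (i # u)) = (\<lambda>u. \<nu>' (i # u))" by auto
      then show "h (\<lambda>u. \<nu> (i # u)) = h (\<lambda>u. \<nu>' (i # u))" by simp
    qed (auto simp: disjoint_family_on_def)
    also have "\<dots> = ennreal (Q ^ n)"
      by (simp add: int_hs ennreal_power Q0)
    finally show ?thesis .
  qed
  have "ennreal (avoid_prob \<kappa> lam \<mu> I x y) = (\<integral>\<^sup>+\<nu>. (\<Prod>i<\<nu> []. h (\<lambda>u. \<nu> (i # u))) \<partial>?N)"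
    unfolding ennreal_avoid_prob nn_integral_displacements_branch[OF I] h_def R_def ..
  also have "\<dots> = (\<integral>\<^sup>+\<nu>. \<integral>\<^sup>+n. indicator {\<nu>. \<nu> [] = n} \<nu> * (\<Prod>i<n. h (\<lambda>u. \<nu> (i # u))) \<partial>count_space UNIV \<partial>?N)"
  proof (rule nn_integral_cong)
    fix \<nu> :: "nat list \<Rightarrow> nat"
    show "(\<Prod>i<\<nu> []. h (\<lambda>u. \<nu> (i # u))) =
      (\<integral>\<^sup>+n. indicator {\<nu>. \<nu> [] = n} \<nu> * (\<Prod>i<n. h (\<lambda>u. \<nu> (i # u))) \<partial>count_space UNIV)"
      by (subst nn_integral_count_space'[where A = "{\<nu> []}"]) (auto simp: indicator_def)
  qed
  also have "\<dots> = (\<integral>\<^sup>+n. \<integral>\<^sup>+\<nu>. indicator {\<nu>. \<nu> [] = n} \<nu> * (\<Prod>i<n. h (\<lambda>u. \<nu> (i # u))) \<partial>?N \<partial>count_space UNIV)"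
    by (rule nn_integral_count_space_nn_integral) auto
  also have "\<dots> = (\<integral>\<^sup>+n. ennreal (Q ^ n) \<partial>measure_pmf \<mu>)"
    unfolding fixed by (rule nn_integral_measure_pmf[symmetric])
  also have "\<dots> = ennreal (measure_pmf.expectation \<mu> (\<lambda>n. Q ^ n))"
    by (rule nn_integral_eq_integral[OF measure_pmf.integrable_const_bound[where B = 1]])
       (auto simp: Q0 Q1 power_le_one)
  finally show ?thesis
    unfolding Q_def[symmetric]
    by (subst (asm) ennreal_inj) (auto intro!: integral_nonneg_AE simp: Q0)
qed

section \<open>Offspring generating functions\<close>

definition pgf :: "nat pmf \<Rightarrow> real \<Rightarrow> real" where
  "pgf \<mu> s = measure_pmf.expectation \<mu> (\<lambda>n. s ^ n)"

lemma integrable_pgf: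
  assumes "0 \<le> s" "s \<le> 1"
  shows "integrable (measure_pmf \<mu>) (\<lambda>n. s ^ n :: real)"
  by (rule measure_pmf.integrable_const_bound[where B = 1]) (use assms in \<open>auto simp: power_le_one\<close>)

lemma pgf_mono:
  assumes "0 \<le> s" "s \<le> t" "t \<le> 1"
  shows "pgf \<mu> s \<le> pgf \<mu> t"
  unfolding pgf_def
  by (rule integral_mono[OF integrable_pgf integrable_pgf]) (use assms in \<open>auto intro: power_mono\<close>)

lemma AE_pos_pmf:
  fixes \<mu> :: "nat pmf"
  assumes "pmf \<mu> 0 = 0"
  shows "AE n in measure_pmf \<mu>. 1 \<le> n"
  using assms by (auto simp: AE_measure_pmf_iff Suc_le_eq set_pmf_iff intro: gr0I)

lemma pgf_le:
  assumes "pmf \<mu> 0 = 0" "0 \<le> s" "s \<le> 1"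
  shows "pgf \<mu> s \<le> s"
proof -
  have "pgf \<mu> s \<le> measure_pmf.expectation \<mu> (\<lambda>n. s)"
    unfolding pgf_def
  proof (rule integral_mono_AE[OF integrable_pgf])
    show "AE n in measure_pmf \<mu>. s ^ n \<le> s"
      using AE_pos_pmf[OF assms(1)]
    proof eventually_elim
      case (elim n)
      then show ?case using power_decreasing[of 1 n s] assms by simp
    qed
  qed (use assms in auto)
  then show ?thesis by simp
qed

lemma pgf_0: "pmf \<mu> 0 = 0 \<Longrightarrow> pgf \<mu> 0 = 0"
  using pgf_le[of \<mu> 0] by (auto intro!: antisym simp: pgf_def integral_nonneg_AE)

text \<open>Since \<open>\<mu>\<close> puts no mass at 0 and is not concentrated at 1, it charges
  some \<open>k \<ge> 2\<close>, where \<open>s ^ k\<close> falls strictly below \<open>s\<close>;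
  elsewhere \<open>s ^ n \<le> s\<close>.\<close>

lemma pgf_less:
  assumes "pmf \<mu> 0 = 0" "pmf \<mu> 1 < 1" "0 < s" "s < 1"
  shows "pgf \<mu> s < s"
proof -
  have "\<exists>k\<in>set_pmf \<mu>. k \<noteq> 1"
  proof (rule ccontr)
    assume "\<not> ?thesis"
    then have "set_pmf \<mu> \<subseteq> {1}" by auto
    then have "\<mu> = return_pmf 1" by (simp add: set_pmf_subset_singleton)
    with assms(2) show False by simp
  qed
  then obtain k where k: "k \<in> set_pmf \<mu>" "2 \<le> k"
    using assms(1) by (metis One_nat_def Suc_1 less_2_cases_iff not_less_eq_eq pmf_eq_0_set_pmf not_le)
  define c where "c = s - s ^ k"
  have "s ^ k \<le> s ^ 2" using k assms by (intro power_decreasing) auto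
  also have "\<dots> < s" using assms by (simp add: power2_eq_square)
  finally have c: "0 < c" by (simp add: c_def)
  have "pgf \<mu> s \<le> measure_pmf.expectation \<mu> (\<lambda>n. s - c * indicator {k} n)"
    unfolding pgf_def
  proof (rule integral_mono_AE[OF integrable_pgf])
    show "AE n in measure_pmf \<mu>. s ^ n \<le> s - c * indicator {k} n"
      using AE_pos_pmf[OF assms(1)]
    proof eventually_elim
      case (elim n)
      then show ?case using power_decreasing[of 1 n s] assms by (auto simp: indicator_def c_def)
    qed
  qed (use assms in \<open>auto intro!: measure_pmf.integrable_const_bound[where B = "\<bar>s\<bar> + \<bar>c\<bar>"] simp: indicator_def\<close>)
  also have "\<dots> = s - c * pmf \<mu> k"
    by (subst Bochner_Integration.integral_diff) (simp_all add: measure_pmf_single less_top[symmetric])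
  also have "\<dots> < s" using c k by (simp add: pmf_positive)
  finally show ?thesis .
qed

text \<open>By Bernoulli's inequality. In probabilistic terms this is the union bound over the
  children.\<close>

lemma pgf_lower_bound:
  assumes int: "integrable (measure_pmf \<mu>) real" and "0 \<le> t" "t \<le> 1"
  shows "1 - measure_pmf.expectation \<mu> real * t \<le> pgf \<mu> (1 - t)"
proof -
  have "measure_pmf.expectation \<mu> (\<lambda>n. 1 - real n * t) \<le> pgf \<mu> (1 - t)"
    unfolding pgf_def
  proof (rule integral_mono)
    fix n
    show "1 - real n * t \<le> (1 - t) ^ n"
      using Bernoulli_inequality[of "- t" n] assms by simp
  qed (use assms in \<open>auto intro!: integrable_pgf\<close>)
  then show ?thesis using int by simp
qed

text \<open>The slope of \<open>pgf\<close> at 1 is the mean. No second moment is available, so the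
  difference quotient, the expectation of \<open>?s t\<close>, is handled by dominated
  convergence.\<close>

lemma pgf_upper_bound:
  assumes int: "integrable (measure_pmf \<mu>) real" and m': "m' < measure_pmf.expectation \<mu> real"
  shows "\<exists>t0>0. t0 \<le> 1 \<and> (\<forall>t. 0 \<le> t \<and> t \<le> t0 \<longrightarrow> pgf \<mu> (1 - t) \<le> 1 - m' * t)"
proof -
  let ?s = "\<lambda>t n. (\<Sum>i<n. (1 - t) ^ i) :: real"
  have s_le: "0 \<le> ?s t n \<and> ?s t n \<le> real n" if "0 \<le> t" "t \<le> 1" for t n
    using that sum_bounded_above[of "{..<n}" "\<lambda>i. (1 - t) ^ i" 1]
    by (auto intro!: sum_nonneg simp: power_le_one)
  have int_s: "integrable (measure_pmf \<mu>) (?s t)" if "0 \<le> t" "t \<le> 1" for t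
    by (rule Bochner_Integration.integrable_bound[OF int]) (use s_le[OF that] in auto)
  have "(\<lambda>k. measure_pmf.expectation \<mu> (?s (1 / real (Suc k)))) \<longlonglongrightarrow> measure_pmf.expectation \<mu> real"
  proof (rule integral_dominated_convergence[where w = real])
    show "AE n in measure_pmf \<mu>. (\<lambda>k. ?s (1 / real (Suc k)) n) \<longlonglongrightarrow> real n"
    proof (rule AE_I2)
      fix n
      have "(\<lambda>k. 1 / real (Suc k)) \<longlonglongrightarrow> 0" by (rule LIMSEQ_Suc[OF lim_1_over_n])
      then have "(\<lambda>k. ?s (1 / real (Suc k)) n) \<longlonglongrightarrow> (\<Sum>i<n. (1 - 0) ^ i)"
        by (intro tendsto_intros)
      then show "(\<lambda>k. ?s (1 / real (Suc k)) n) \<longlonglongrightarrow> real n" by simp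
    qed
    show "AE n in measure_pmf \<mu>. norm (?s (1 / real (Suc k)) n) \<le> real n" for k
      using s_le[of "1 / real (Suc k)"] by (intro AE_I2) simp
  qed (use int in auto)
  from order_tendstoD(1)[OF this m'] obtain k where k: "m' < measure_pmf.expectation \<mu> (?s (1 / real (Suc k)))"
    by (auto simp: eventually_sequentially)
  define t0 where "t0 = 1 / real (Suc k)"
  have t0: "0 < t0" "t0 \<le> 1" by (auto simp: t0_def)
  have "pgf \<mu> (1 - t) \<le> 1 - m' * t" if t: "0 \<le> t" "t \<le> t0" for t
  proof -
    have "m' \<le> measure_pmf.expectation \<mu> (?s t0)" using k by (simp add: t0_def)
    also have "\<dots> \<le> measure_pmf.expectation \<mu> (?s t)"
      \<comment> \<open>The difference quotient increases as \<open>t\<close> decreases, so one good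
        \<open>t0\<close> serves all smaller \<open>t\<close>.\<close>
      by (rule integral_mono[OF int_s int_s]) (use t t0 in \<open>auto intro!: sum_mono power_mono\<close>)
    finally have "t * m' \<le> t * measure_pmf.expectation \<mu> (?s t)" using t by (intro mult_left_mono) auto
    moreover have "pgf \<mu> (1 - t) = 1 - t * measure_pmf.expectation \<mu> (?s t)"
    proof -
      have eq: "(1 - t) ^ n = 1 - t * ?s t n" for n
        using one_diff_power_eq[of "1 - t" n] by simp
      have "pgf \<mu> (1 - t) = measure_pmf.expectation \<mu> (\<lambda>n. 1 - t * ?s t n)"
        unfolding pgf_def by (intro Bochner_Integration.integral_cong refl eq)
      also have "\<dots> = 1 - t * measure_pmf.expectation \<mu> (?s t)"
        using int_s[of t] t t0 by (subst Bochner_Integration.integral_diff) auto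
      finally show ?thesis .
    qed
    ultimately show ?thesis by (simp add: mult.commute)
  qed
  with t0 show ?thesis by blast
qed

section \<open>The biased walk\<close>

text \<open>The walk lives on all words rather than on the tree only. Positivity of
  \<open>\<kappa>\<close> everywhere holds almost surely because leaves have probability 0, and it
  makes every kernel well defined.\<close>

locale biased_walk =
  fixes \<kappa> :: "nat list \<Rightarrow> nat" and lam :: real
  assumes kappa_pos: "\<And>y. 0 < \<kappa> y" and lam_pos: "0 < lam"
begin

definition P :: "(nat list \<Rightarrow> real) \<Rightarrow> nat list \<Rightarrow> real" where
  "P f y = measure_pmf.expectation (lb_step \<kappa> lam y) f"

lemma finite_set_lb_step: "finite (set_pmf (lb_step \<kappa> lam y))"
proof -
  have "finite (set_pmf (pmf_of_set {..<\<kappa> y}))"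
    using kappa_pos[of y] by (subst set_pmf_of_set) (auto simp: lessThan_empty_iff)
  then have fin: "finite (set_pmf (map_pmf (\<lambda>i. y @ [i]) (pmf_of_set {..<\<kappa> y})))"
    by simp
  show ?thesis
    unfolding lb_step_def
    by (cases "y = []", use fin in simp) (simp only: if_False set_bind_pmf, rule finite_UN_I, use fin in auto)
qed

lemma integrable_lb_step: "integrable (measure_pmf (lb_step \<kappa> lam y)) (f :: nat list \<Rightarrow> real)"
  by (rule integrable_measure_pmf_finite[OF finite_set_lb_step])

lemma P_Nil: "P f [] = (\<Sum>i<\<kappa> []. f [i]) / \<kappa> []"
  using kappa_pos[of "[]"]
  by (simp add: P_def lb_step_def integral_pmf_of_set lessThan_empty_iff)

lemma P_step:
  assumes "y \<noteq> []"
  shows "P f y = (lam * f (butlast y) + (\<Sum>i<\<kappa> y. f (y @ [i]))) / (lam + \<kappa> y)"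
proof -
  have k: "0 < real (\<kappa> y)" using kappa_pos[of y] by simp
  have "P f y = (\<Sum>a\<in>UNIV. pmf (bernoulli_pmf (lam / (lam + real (\<kappa> y)))) a *\<^sub>R
      measure_pmf.expectation (if a then return_pmf (butlast y) else map_pmf (\<lambda>i. y @ [i]) (pmf_of_set {..<\<kappa> y})) f)"
    unfolding P_def lb_step_def using assms k
    by (simp only: if_False) (rule pmf_expectation_bind, auto simp: lessThan_empty_iff)
  also have "\<dots> = lam / (lam + \<kappa> y) * f (butlast y) + (1 - lam / (lam + \<kappa> y)) * ((\<Sum>i<\<kappa> y. f (y @ [i])) / \<kappa> y)"
    using k lam_pos by (simp add: UNIV_bool integral_pmf_of_set lessThan_empty_iff)
  also have "1 - lam / (lam + \<kappa> y) = \<kappa> y / (lam + \<kappa> y)" using k lam_pos by (simp add: field_simps)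
  finally show ?thesis using k lam_pos by (simp add: add_divide_distrib)
qed

lemma P_mono: "(\<And>z. f z \<le> g z) \<Longrightarrow> P f y \<le> P g y"
  unfolding P_def by (rule integral_mono[OF integrable_lb_step integrable_lb_step])

lemma P_const [simp]: "P (\<lambda>_. c) y = c"
  by (simp add: P_def)

lemma P_add: "P (\<lambda>z. f z + g z) y = P f y + P g y"
  unfolding P_def by (rule Bochner_Integration.integral_add[OF integrable_lb_step integrable_lb_step])

lemma P_diff: "P (\<lambda>z. f z - g z) y = P f y - P g y"
  unfolding P_def by (rule Bochner_Integration.integral_diff[OF integrable_lb_step integrable_lb_step])

lemma P_cmult: "P (\<lambda>z. c * f z) y = c * P f y"
  by (simp add: P_def)

lemma P_nonneg: "(\<And>z. 0 \<le> f z) \<Longrightarrow> 0 \<le> P f y"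
  using P_mono[of "\<lambda>_. 0" f y] by simp

lemma P_ge_child:
  assumes "\<And>z. 0 \<le> f z" "i < \<kappa> y"
  shows "f (y @ [i]) / (lam + \<kappa> y) \<le> P f y"
proof -
  have k: "0 < real (\<kappa> y)" using kappa_pos[of y] by simp
  have le: "f (y @ [i]) \<le> (\<Sum>i<\<kappa> y. f (y @ [i]))"
    using assms by (intro member_le_sum) auto
  show ?thesis
  proof (cases "y = []")
    case True
    have "f (y @ [i]) / (lam + \<kappa> y) \<le> f (y @ [i]) / \<kappa> y"
      using k lam_pos assms by (intro divide_left_mono mult_pos_pos) auto
    also have "\<dots> \<le> P f y"
      using le k True by (auto simp: P_Nil intro: divide_right_mono)
    finally show ?thesis .
  next
    case False
    have "0 \<le> lam * f (butlast y)" using assms lam_pos by simp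
    then show ?thesis
      unfolding P_step[OF False] using le k lam_pos by (intro divide_right_mono) auto
  qed
qed

lemma P_ge_parent:
  assumes "\<And>z. 0 \<le> f z" "y \<noteq> []"
  shows "lam * f (butlast y) / (lam + \<kappa> y) \<le> P f y"
  unfolding P_step[OF assms(2)] using lam_pos assms by (intro divide_right_mono) (auto intro: sum_nonneg)

end

section \<open>Avoiding a vertex\<close>

locale biased_brw = biased_walk +
  fixes \<mu> :: "nat pmf" and m :: real
  assumes mu0: "pmf \<mu> 0 = 0" and mu1: "pmf \<mu> 1 < 1"
    and mumean: "integrable (measure_pmf \<mu>) real"
    and m_def: "m = measure_pmf.expectation \<mu> real"
begin

abbreviation avoid :: "nat set \<Rightarrow> nat list \<Rightarrow> nat list \<Rightarrow> real" where
  "avoid \<equiv> avoid_prob \<kappa> lam \<mu>"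

abbreviation q :: "nat list \<Rightarrow> nat list \<Rightarrow> real" where
  "q \<equiv> avoid UNIV"

sublocale B: prob_space "brw_space \<kappa> lam \<mu>"
  by (rule prob_space_brw_space)

lemma avoid_rec: "0 \<notin> I \<Longrightarrow> avoid I x y = pgf \<mu> (P (avoid {n. Suc n \<in> I} x) y)"
  by (simp add: avoid_prob_branch pgf_def P_def)

lemma P_avoid_bounds: "0 \<le> P (avoid I x) y" "P (avoid I x) y \<le> 1"
  using P_nonneg[of "avoid I x" y] P_mono[of "avoid I x" "\<lambda>_. 1" y] by auto

lemma q_self: "q x x = 0"
proof -
  have "\<not> avoids UNIV x \<nu> \<xi> x" for \<nu> \<xi>
    unfolding avoids_def using brw_pos_Nil[of \<xi> x] in_tree_Nil[of \<nu>] by blast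
  then show ?thesis by (simp add: avoid_prob_def)
qed

lemma q_le_pgf: "q x y \<le> pgf \<mu> (P (q x) y)"
proof -
  have "q x y \<le> avoid (UNIV - {0}) x y"
    unfolding avoid_prob_def
    by (rule B.finite_measure_mono[OF _ sets_avoids]) (auto simp: avoids_def)
  also have "\<dots> = pgf \<mu> (P (q x) y)"
    by (subst avoid_rec) auto
  finally show ?thesis .
qed

lemma q_le_P: "q x y \<le> P (q x) y"
  using q_le_pgf[of x y] pgf_le[OF mu0 P_avoid_bounds, of UNIV x y] by simp

text \<open>The hitting probability \<open>1 - q x\<close> is superharmonic and equals 1 at
  \<open>x\<close>, so positivity spreads along every path that leads to \<open>x\<close>.\<close>

lemma q_less_1:
  assumes "in_tree \<kappa> x"
  shows "q x y < 1"
proof -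
  define a where "a = (\<lambda>y. 1 - q x y)"
  have a_nonneg: "0 \<le> a y" for y by (simp add: a_def)
  have a_P: "P a y \<le> a y" for y
    using q_le_P[of x y] by (simp add: a_def P_diff)
  have pos: "0 < lam + \<kappa> y" for y using lam_pos by simp
  \<comment> \<open>From \<open>x\<close> back to the root along its ancestors; membership in the
    tree makes each downward step possible.\<close>
  have "k \<le> length x \<Longrightarrow> 0 < a (take k x)" for k
  proof (induction k rule: inc_induct[where j = "length x"])
    case base
    show ?case by (simp add: a_def q_self)
  next
    case (step k)
    have "x ! k < \<kappa> (take k x)" using assms step(2) by (auto simp: in_tree_def)
    from P_ge_child[of a, OF a_nonneg this] a_P[of "take k x"]
    have "a (take (Suc k) x) / (lam + \<kappa> (take k x)) \<le> a (take k x)"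
      using step(2) by (simp add: take_Suc_conv_app_nth)
    then show ?case using step pos[of "take k x"]
      by (smt (verit, best) divide_pos_pos)
  qed
  from this[of 0] have root: "0 < a []" by simp
  \<comment> \<open>Any word can move up to the root, since the step to the parent always has
    positive probability.\<close>
  have "0 < a y"
  proof (induction y rule: rev_induct)
    case (snoc i y)
    have "lam * a y / (lam + \<kappa> (y @ [i])) \<le> a (y @ [i])"
      using P_ge_parent[of a "y @ [i]", OF a_nonneg] a_P[of "y @ [i]"] by simp
    moreover have "0 < lam * a y / (lam + \<kappa> (y @ [i]))"
      using snoc lam_pos pos[of "y @ [i]"] by simp
    ultimately show ?case by simp
  qed (rule root)
  then show ?thesis by (simp add: a_def)
qed

text \<open>Since \<open>pgf \<mu> s < s\<close> on the open unit interval, the supremum of \<open>q x\<close> is 0 or 1.\<close>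

lemma q_eq_0:
  assumes c: "0 < c" and le: "\<And>y. q x y \<le> 1 - c"
  shows "q x y = 0"
proof -
  define S where "S = (SUP y. q x y)"
  have bdd: "bdd_above (range (q x))" by (rule bdd_aboveI2[where M = 1]) simp
  have q_S: "q x y \<le> S" for y unfolding S_def by (rule cSUP_upper[OF _ bdd]) simp
  have S0: "0 \<le> S" using q_S[of y] avoid_prob_nonneg[of \<kappa> lam \<mu> UNIV x y] by linarith
  have S1: "S < 1" using cSUP_least[of UNIV "q x" "1 - c"] le c by (simp add: S_def)
  have "S \<le> pgf \<mu> S"
    unfolding S_def
  proof (rule cSUP_least, simp, fold S_def)
    fix y
    have "P (q x) y \<le> S" using P_mono[of "q x" "\<lambda>_. S" y] q_S by simp
    then show "q x y \<le> pgf \<mu> S"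
      using q_le_pgf[of x y] pgf_mono[OF P_avoid_bounds(1), of UNIV x y S \<mu>] S1 by simp
  qed
  then have "S = 0"
    using pgf_less[OF mu0 mu1, of S] S0 S1 by fastforce
  then show ?thesis using q_S[of y] by (simp add: antisym)
qed

lemma sets_not_avoids:
  "{(\<nu>, \<xi>). \<not> avoids I x \<nu> \<xi> y} \<in> sets (brw_space \<kappa> lam \<mu>)"
proof -
  have "{(\<nu>, \<xi>). \<not> avoids I x \<nu> \<xi> y} = space (brw_space \<kappa> lam \<mu>) - {(\<nu>, \<xi>). avoids I x \<nu> \<xi> y}"
    by auto
  then show ?thesis using sets_avoids by (metis sets.compl_sets)
qed

lemma recurrent_event_eq:
  "{(\<nu>, \<xi>). \<forall>n. \<exists>u. in_tree \<nu> u \<and> n \<le> length u \<and> brw_pos \<xi> x u = x} =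
    (\<Inter>n. {(\<nu>, \<xi>). \<not> avoids {n..} x \<nu> \<xi> x})"
  by (auto simp: avoids_def)

lemma sets_recurrent_event:
  "(\<Inter>n. {(\<nu>, \<xi>). \<not> avoids {n..} x \<nu> \<xi> x}) \<in> sets (brw_space \<kappa> lam \<mu>)"
  by (rule sets.countable_INT) (auto intro: sets_not_avoids)

text \<open>If \<open>x\<close> is hit almost surely from everywhere, the branching recursion with
  \<open>pgf \<mu> 0 = 0\<close> shows the same for hits from generation \<open>N\<close> on.
  Intersecting over \<open>N\<close> gives infinitely many generations.\<close>

lemma brw_alpha_eq_1:
  assumes "\<And>y. q x y = 0"
  shows "brw_alpha \<kappa> lam \<mu> x = 1"
proof -
  have "avoid {N..} x = (\<lambda>_. 0)" for N
  proof (induction N)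
    case 0
    have "{0::nat..} = UNIV" by auto
    then show ?case using assms by auto
  next
    case (Suc N)
    have "{n. Suc n \<in> {Suc N..}} = {N..}" by auto
    with Suc show ?case
      by (auto simp: avoid_rec pgf_0[OF mu0])
  qed
  then have "B.prob {(\<nu>, \<xi>). avoids {N..} x \<nu> \<xi> x} = 0" for N
    unfolding avoid_prob_def by meson
  then have "AE \<omega> in brw_space \<kappa> lam \<mu>. \<omega> \<notin> {(\<nu>, \<xi>). avoids {N..} x \<nu> \<xi> x}" for N
    by (intro AE_not_in) (simp add: null_sets_def B.emeasure_eq_measure sets_avoids)
  then have "AE \<omega> in brw_space \<kappa> lam \<mu>. \<forall>N. \<omega> \<notin> {(\<nu>, \<xi>). avoids {N..} x \<nu> \<xi> x}"
    by (subst AE_all_countable) blast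
  then have "AE \<omega> in brw_space \<kappa> lam \<mu>. \<omega> \<in> (\<Inter>n. {(\<nu>, \<xi>). \<not> avoids {n..} x \<nu> \<xi> x})"
    by eventually_elim auto
  then have "B.prob (\<Inter>n. {(\<nu>, \<xi>). \<not> avoids {n..} x \<nu> \<xi> x}) = 1"
    by (simp only: B.prob_eq_1[OF sets_recurrent_event])
  then show ?thesis
    unfolding brw_alpha_def recurrent_event_eq .
qed

section \<open>Transience\<close>

definition hit :: "nat list \<Rightarrow> nat \<Rightarrow> nat list \<Rightarrow> real" where
  "hit x N y = 1 - avoid {N} x y"

lemma hit_0: "hit x 0 y = indicator {x} y"
proof -
  have "avoids {0} x \<nu> \<xi> y \<longleftrightarrow> y \<noteq> x" for \<nu> \<xi>
    by (auto simp: avoids_def)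
  then have "avoid {0} x y = (if y = x then 0 else 1)"
    using B.prob_space by (auto simp: avoid_prob_def case_prod_unfold)
  then show ?thesis by (simp add: hit_def)
qed

lemma hit_Suc: "hit x (Suc N) y \<le> m * P (hit x N) y"
proof -
  have "P (hit x N) y = 1 - P (avoid {N} x) y"
    unfolding hit_def by (simp add: P_diff)
  moreover have "avoid {Suc N} x y = pgf \<mu> (P (avoid {N} x) y)"
    by (subst avoid_rec) auto
  ultimately show ?thesis
    using pgf_lower_bound[OF mumean, of "P (hit x N) y"] P_avoid_bounds[of "{N}" x y]
    by (simp add: hit_def m_def)
qed

lemma m_ge_1: "1 \<le> m"
proof -
  have "1 = measure_pmf.expectation \<mu> (\<lambda>n. 1 :: real)" by simp
  also have "\<dots> \<le> m"
    unfolding m_def using AE_pos_pmf[OF mu0] mumean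
    by (intro integral_mono_AE) (auto elim: eventually_mono)
  finally show ?thesis .
qed

lemma funpow_P_mono: "(\<And>z. f z \<le> g z) \<Longrightarrow> (P ^^ n) f y \<le> (P ^^ n) g y"
  by (induction n arbitrary: y) (auto intro: P_mono)

lemma funpow_P_cmult: "(P ^^ n) (\<lambda>z. c * f z) y = c * (P ^^ n) f y"
proof (induction n arbitrary: y)
  case (Suc n)
  then have "(P ^^ n) (\<lambda>z. c * f z) = (\<lambda>z. c * (P ^^ n) f z)" by auto
  then show ?case by (simp add: P_cmult)
qed simp

lemma funpow_P_nonneg: "(\<And>z. 0 \<le> f z) \<Longrightarrow> 0 \<le> (P ^^ n) f y"
  by (induction n arbitrary: y) (auto intro: P_nonneg)

text \<open>The many-to-one bound: the right side is the expected number of particles at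
  \<open>x\<close> in generation \<open>N\<close>.\<close>

lemma hit_le: "hit x N y \<le> m ^ N * (P ^^ N) (indicator {x}) y"
proof (induction N arbitrary: y)
  case (Suc N)
  have "hit x (Suc N) y \<le> m * P (hit x N) y" by (rule hit_Suc)
  also have "\<dots> \<le> m * P (\<lambda>z. m ^ N * (P ^^ N) (indicator {x}) z) y"
    using m_ge_1 by (intro mult_left_mono P_mono Suc) auto
  finally show ?case by (simp add: P_cmult)
qed (simp add: hit_0)

text \<open>Borel-Cantelli over the generations.\<close>

lemma brw_alpha_eq_0:
  assumes "summable (\<lambda>N. hit x N x)"
  shows "brw_alpha \<kappa> lam \<mu> x = 0"
proof -
  let ?A = "\<lambda>N. {(\<nu>, \<xi>). \<not> avoids {N} x \<nu> \<xi> x}"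
  have "B.prob (?A N) = hit x N x" for N
  proof -
    have "?A N = space (brw_space \<kappa> lam \<mu>) - {(\<nu>, \<xi>). avoids {N} x \<nu> \<xi> x}" by auto
    then show ?thesis
      using B.prob_compl[OF sets_avoids[of "{N}" x x]] by (simp add: hit_def avoid_prob_def)
  qed
  then have "summable (\<lambda>N. B.prob (?A N))" using assms by simp
  then have "AE \<omega> in brw_space \<kappa> lam \<mu>. eventually (\<lambda>N. \<omega> \<in> space (brw_space \<kappa> lam \<mu>) - ?A N) sequentially"
    by (intro borel_cantelli_AE1 sets_not_avoids) (simp_all add: B.emeasure_eq_measure)
  then have "AE \<omega> in brw_space \<kappa> lam \<mu>. \<omega> \<notin> (\<Inter>n. {(\<nu>, \<xi>). \<not> avoids {n..} x \<nu> \<xi> x})"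
  proof eventually_elim
    case (elim \<omega>)
    obtain \<nu> \<xi> where [simp]: "\<omega> = (\<nu>, \<xi>)" by (cases \<omega>)
    from elim obtain n where "\<And>N. n \<le> N \<Longrightarrow> avoids {N} x \<nu> \<xi> x"
      by (auto simp: eventually_sequentially)
    then have "avoids {n..} x \<nu> \<xi> x" by (auto simp: avoids_def)
    then show ?case by auto
  qed
  then have "B.prob (\<Inter>n. {(\<nu>, \<xi>). \<not> avoids {n..} x \<nu> \<xi> x}) = 0"
    by (simp only: B.prob_eq_0[OF sets_recurrent_event])
  then show ?thesis
    unfolding brw_alpha_def recurrent_event_eq .
qed

lemma P_sum: "P (\<lambda>z. \<Sum>n<M. f n z) y = (\<Sum>n<M. P (f n) y)" for M :: nat
  by (induction M) (simp_all add: P_add)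

text \<open>A function \<open>f\<close> with \<open>m * P f \<le> f\<close>, strictly at the root, bounds the expected number of visits
  to the root; the root is reached from every vertex \<open>x\<close> with positive probability, so the same holds for \<open>x\<close>.\<close>

lemma summable_hit:
  assumes f: "\<And>y. 0 \<le> f y" and sup: "\<And>y. indicator {[]} y + m * P f y \<le> f y"
  shows "summable (\<lambda>N. hit x N y)"
proof -
  \<comment> \<open>The expected number of particles of generation \<open>n\<close> at the
    root.\<close>
  define h where "h n = (\<lambda>y. m ^ n * (P ^^ n) (indicator {[]}) y)" for n
  have h0: "0 \<le> h n y" for n y
    unfolding h_def using m_ge_1 by (intro mult_nonneg_nonneg funpow_P_nonneg) auto
  have h_Suc: "h (Suc n) y = m * P (h n) y" for n y
    by (simp add: h_def P_cmult)
  have le: "(\<Sum>n<M. h n y) \<le> f y" for M y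
  proof (induction M arbitrary: y)
    case (Suc M)
    have "(\<Sum>n<Suc M. h n y) = indicator {[]} y + m * P (\<lambda>z. \<Sum>n<M. h n z) y"
      unfolding sum.lessThan_Suc_shift by (simp add: h_Suc P_sum sum_distrib_left) (simp add: h_def)
    also have "\<dots> \<le> indicator {[]} y + m * P f y"
      using Suc m_ge_1 by (intro add_left_mono mult_left_mono P_mono) auto
    also have "\<dots> \<le> f y" by (rule sup)
    finally show ?case .
  qed (simp add: f)
  have sum_h: "summable (\<lambda>n. h n y)" for y
    by (rule summableI_nonneg_bounded[OF h0 le])
  \<comment> \<open>Moving straight up takes exactly \<open>length x\<close> steps, so visits to
    \<open>x\<close> at time \<open>N\<close> are compared with visits to the root at time
    \<open>N + length x\<close>.\<close>
  have "\<exists>\<zeta>>0. \<forall>z. \<zeta> * indicator {x} z \<le> (P ^^ length x) (indicator {[]}) z"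
  proof (induction x rule: rev_induct)
    case Nil
    show ?case by (intro exI[of _ 1]) auto
  next
    case (snoc i x)
    then obtain \<zeta> where \<zeta>: "0 < \<zeta>" "\<And>z. \<zeta> * indicator {x} z \<le> (P ^^ length x) (indicator {[]}) z"
      by auto
    define c where "c = lam / (lam + \<kappa> (x @ [i]))"
    have c: "0 < c" using lam_pos by (simp add: c_def add_pos_nonneg)
    have nn: "0 \<le> (P ^^ n) (indicator {[]}) z" for n z by (rule funpow_P_nonneg) simp
    have "c * \<zeta> * indicator {x @ [i]} z \<le> (P ^^ Suc (length x)) (indicator {[]}) z" for z
    proof (cases "z = x @ [i]")
      case True
      have "c * \<zeta> \<le> c * (P ^^ length x) (indicator {[]}) x"
        using \<zeta>(2)[of x] c by (intro mult_left_mono) auto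
      also have "\<dots> \<le> P ((P ^^ length x) (indicator {[]})) (x @ [i])"
        using P_ge_parent[of "(P ^^ length x) (indicator {[]})" "x @ [i]", OF nn] by (simp add: c_def)
      finally show ?thesis using True by simp
    next
      case False
      then show ?thesis using nn[of "Suc (length x)" z] by simp
    qed
    then show ?case using c \<zeta>(1) by (intro exI[of _ "c * \<zeta>"]) simp
  qed
  then obtain \<zeta> where \<zeta>: "0 < \<zeta>" "\<And>z. \<zeta> * indicator {x} z \<le> (P ^^ length x) (indicator {[]}) z"
    by blast
  have "norm (hit x N y) \<le> inverse \<zeta> * h (N + length x) y" for N
  proof -
    have "0 \<le> hit x N y" by (simp add: hit_def)
    moreover have "hit x N y \<le> m ^ N * (P ^^ N) (indicator {x}) y" by (rule hit_le)
    moreover have "m ^ N * (P ^^ N) (indicator {x}) y \<le> m ^ (N + length x) * (P ^^ N) (indicator {x}) y"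
      using m_ge_1 by (intro mult_right_mono power_increasing funpow_P_nonneg) auto
    moreover have "\<zeta> * (P ^^ N) (indicator {x}) y \<le> (P ^^ (N + length x)) (indicator {[]}) y"
      using funpow_P_mono[of "\<lambda>z. \<zeta> * indicator {x} z" "(P ^^ length x) (indicator {[]})" N y] \<zeta>(2)
      by (simp add: funpow_P_cmult funpow_add)
    then have "m ^ (N + length x) * (P ^^ N) (indicator {x}) y \<le> inverse \<zeta> * h (N + length x) y"
      using \<zeta>(1) m_ge_1 by (simp add: h_def field_simps)
    ultimately show ?thesis by simp
  qed
  moreover have "summable (\<lambda>N. inverse \<zeta> * h (N + length x) y)"
    by (intro summable_mult summable_ignore_initial_segment sum_h)
  ultimately show ?thesis by (rule summable_comparison_test'[rotated])
qed

lemma transient: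
  assumes d: "\<And>y. d \<le> \<kappa> y" and lam: "lam < real d"
    and m: "m \<le> (real d + lam) / (2 * sqrt (lam * real d))"
  shows "brw_alpha \<kappa> lam \<mu> x = 0"
proof (rule brw_alpha_eq_0)
  define s where "s = sqrt (lam / d)"
  have d0: "0 < real d" using lam lam_pos by linarith
  have s: "0 < s" "s < 1" using lam lam_pos d0 by (auto simp: s_def)
  have lam_s: "lam = d * s\<^sup>2" using lam_pos d0 by (simp add: s_def)
  then have "sqrt (lam * d) = d * s" using d0 s by (simp add: real_sqrt_mult)
  with m have m2: "m * (2 * d * s) \<le> d + lam" using d0 s by (simp add: field_simps)
  \<comment> \<open>Here \<open>lam < d\<close> enters:
    \<open>2 * d * m * s \<le> d + lam < 2 * d\<close>.\<close>
  have ms: "m * s < 1"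
  proof -
    have "m * s * (2 * d) < 1 * (2 * d)" using m2 lam by (simp add: mult_ac)
    then show ?thesis using d0 by simp
  qed
  \<comment> \<open>This scaling turns the inequality at the root into the equality
    \<open>1 + m * C * s = C\<close>.\<close>
  define C where "C = 1 / (1 - m * s)"
  have C: "0 < C" "C * (1 - m * s) = 1" using ms by (auto simp: C_def)
  define f where "f y = C * s ^ length y" for y :: "nat list"
  show "summable (\<lambda>N. hit x N x)"
  proof (rule summable_hit)
    show "0 \<le> f y" for y using C s by (simp add: f_def)
    show "indicator {[]} y + m * P f y \<le> f y" for y
    proof (cases y rule: rev_cases)
      case Nil
      have "P f [] = C * s" using kappa_pos[of "[]"] by (simp add: P_Nil f_def)
      then show ?thesis using C(2) Nil by (simp add: f_def algebra_simps)
    next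
      case (snoc z i)
      let ?k = "real (\<kappa> y)"
      have k: "real d \<le> ?k" using d[of y] by simp
      \<comment> \<open>For exactly \<open>d\<close> children the inequality is the hypothesis on
        \<open>m\<close>; each further child adds \<open>m * s\<close> on the left and 1 on the
        right.\<close>
      have "m * s * (?k - d) \<le> 1 * (?k - d)" using ms k by (intro mult_right_mono) auto
      moreover have "m * (d * s + d * s) \<le> d + lam" using m2 by (simp add: algebra_simps)
      ultimately have key: "m * (d * s + ?k * s) \<le> lam + ?k" by (simp add: algebra_simps)
      have "P f y = C * s ^ length z * (lam + ?k * s\<^sup>2) / (lam + ?k)"
        using snoc by (simp add: P_step f_def power2_eq_square algebra_simps)
      also have "lam + ?k * s\<^sup>2 = s * (d * s + ?k * s)"
        by (simp add: lam_s power2_eq_square algebra_simps)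
      finally have "m * P f y = C * s ^ length z * s * (m * (d * s + ?k * s) / (lam + ?k))"
        by simp
      also have "\<dots> \<le> C * s ^ length z * s * 1"
        using key C s lam_pos d0 k by (intro mult_left_mono) (auto simp: divide_le_eq)
      finally show ?thesis using snoc by (simp add: f_def mult_ac)
    qed
  qed
qed

end

section \<open>Local survival\<close>

text \<open>Degrees are prescribed on a full \<open>b\<close>-ary tree, including words outside the
  actual tree when \<open>c j < b\<close>. The event thus concerns a fixed finite set of independent
  coordinates.\<close>

definition good :: "nat \<Rightarrow> nat \<Rightarrow> (nat \<Rightarrow> nat) \<Rightarrow> (nat list \<Rightarrow> nat) \<Rightarrow> nat list \<Rightarrow> bool" where
  "good k b c \<kappa> v \<longleftrightarrow> (\<forall>w. length w < k \<longrightarrow> set w \<subseteq> {..<b} \<longrightarrow> \<kappa> (v @ w) = c (length w))"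

context biased_brw
begin

text \<open>A bound \<open>q x \<le> 1 - \<epsilon> f\<close> with \<open>f\<close> living on the pattern below a good vertex improves
  by the factor \<open>1 + \<delta>\<close> under \<open>q x \<le> pgf \<mu> (P (q x))\<close> as long as \<open>\<epsilon> \<le> t0\<close>; hence the bound at \<open>v\<close>
  depends neither on \<open>v\<close> nor on \<open>x\<close>.\<close>

lemma q_good:
  fixes a :: "nat \<Rightarrow> real"
  assumes x: "in_tree \<kappa> x" and good: "good k b c \<kappa> v"
    and t0: "0 < t0" "t0 \<le> 1" and pgf: "\<And>t. 0 \<le> t \<Longrightarrow> t \<le> t0 \<Longrightarrow> pgf \<mu> (1 - t) \<le> 1 - m' * t"
    and m': "0 < m'" and \<delta>: "0 < \<delta>"
    and a: "\<And>j. 0 \<le> a j" "\<And>j. a j \<le> 1" "\<And>j. k \<le> j \<Longrightarrow> a j = 0"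
    and c: "\<And>j. j < k \<Longrightarrow> c j \<le> b"
    and sub: "\<And>j. j < k \<Longrightarrow>
      (1 + \<delta>) * (lam + c j) * a j \<le> m' * (lam * (if j = 0 then 0 else a (j - 1)) + c j * a (Suc j))"
  shows "q x v \<le> 1 - t0 * a 0"
proof -
  define f where "f z = (if \<exists>w. z = v @ w \<and> set w \<subseteq> {..<b} then a (length z - length v) else 0)" for z
  have f_app: "f (v @ w) = (if set w \<subseteq> {..<b} then a (length w) else 0)" for w
    by (simp add: f_def)
  have f0: "0 \<le> f z" and f1: "f z \<le> 1" for z
    using a by (auto simp: f_def)
  have Pf0: "0 \<le> P f z" and Pf1: "P f z \<le> 1" for z
    using P_nonneg[of f z] P_mono[of f "\<lambda>_. 1" z] f0 f1 by auto
  have sub_f: "(1 + \<delta>) * f z \<le> m' * P f z" for z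
  proof (cases "\<exists>w. z = v @ w \<and> set w \<subseteq> {..<b} \<and> length w < k")
    case False
    then have "f z = 0" using a(3) by (auto simp: f_def not_less)
    then show ?thesis using m' Pf0 by simp
  next
    case True
    then obtain w where z: "z = v @ w" and w: "set w \<subseteq> {..<b}" "length w < k" by blast
    let ?j = "length w"
    have kz: "\<kappa> z = c ?j" using good w by (simp add: good_def z)
    then have c0: "0 < c ?j" using kappa_pos[of z] by simp
    have "f (z @ [i]) = a (Suc ?j)" if "i < c ?j" for i
      using f_app[of "w @ [i]"] w that c[OF w(2)] by (simp add: z)
    then have children: "(\<Sum>i<\<kappa> z. f (z @ [i])) = c ?j * a (Suc ?j)"
      by (simp add: kz)
    have "(lam * (if ?j = 0 then 0 else a (?j - 1)) + c ?j * a (Suc ?j)) / (lam + c ?j) \<le> P f z"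
    proof (cases "z = []")
      case True
      then have j: "?j = 0" by (simp add: z)
      \<comment> \<open>If the pattern sits at the root of the whole tree there is no upward step to
        be killed, which only increases the mean.\<close>
      have "c ?j * a (Suc ?j) / (lam + c ?j) \<le> c ?j * a (Suc ?j) / c ?j"
        using lam_pos c0 a(1) by (intro divide_left_mono) auto
      moreover have "\<kappa> [] = c ?j" using kz True by simp
      ultimately show ?thesis using True children j by (simp add: P_Nil)
    next
      case False
      have "(if ?j = 0 then 0 else a (?j - 1)) \<le> f (butlast z)"
      proof (cases "w = []")
        case True
        then show ?thesis using f0 by simp
      next
        case False
        have "set (butlast w) \<subseteq> {..<b}" using w(1) by (auto dest: in_set_butlastD)
        then show ?thesis using False f_app[of "butlast w"] by (simp add: z butlast_append)
      qed
      then show ?thesis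
        unfolding P_step[OF False] children unfolding kz
        using lam_pos by (intro divide_right_mono add_right_mono mult_left_mono) auto
    qed
    then have "m' * ((lam * (if ?j = 0 then 0 else a (?j - 1)) + c ?j * a (Suc ?j)) / (lam + c ?j)) \<le> m' * P f z"
      using m' by (intro mult_left_mono) auto
    moreover have "(1 + \<delta>) * a ?j \<le> m' * ((lam * (if ?j = 0 then 0 else a (?j - 1)) + c ?j * a (Suc ?j)) / (lam + c ?j))"
      using sub[OF w(2)] lam_pos c0 by (simp add: field_simps)
    ultimately show ?thesis using f_app[of w] w by (simp add: z)
  qed
  have improve: "q x z \<le> 1 - (1 + \<delta>) * \<epsilon> * f z"
    if \<epsilon>: "0 \<le> \<epsilon>" "\<epsilon> \<le> t0" and le: "\<And>z. q x z \<le> 1 - \<epsilon> * f z" for \<epsilon> z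
  proof -
    have "P (q x) z \<le> 1 - \<epsilon> * P f z"
      using P_mono[of "q x" "\<lambda>z. 1 - \<epsilon> * f z" z] le by (simp add: P_diff P_cmult)
    then have "q x z \<le> pgf \<mu> (1 - \<epsilon> * P f z)"
      using q_le_pgf[of x z] pgf_mono[OF P_avoid_bounds(1), of UNIV x z "1 - \<epsilon> * P f z" \<mu>] \<epsilon> Pf0[of z] by simp
    also have "\<dots> \<le> 1 - m' * (\<epsilon> * P f z)"
    proof (rule pgf)
      have "\<epsilon> * P f z \<le> \<epsilon> * 1" using \<epsilon> Pf1 by (intro mult_left_mono) auto
      then show "\<epsilon> * P f z \<le> t0" using \<epsilon> by simp
    qed (use \<epsilon> Pf0 in auto)
    also have "\<dots> \<le> 1 - \<epsilon> * ((1 + \<delta>) * f z)"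
      using mult_left_mono[OF sub_f[of z] \<epsilon>(1)] by (simp add: mult_ac)
    finally show ?thesis by (simp add: mult_ac)
  qed
  define U where "U = {v @ w | w. set w \<subseteq> {..<b} \<and> length w \<le> k}"
  have "finite {w. set w \<subseteq> {..<b} \<and> length w \<le> k}"
    by (rule finite_lists_length_le) simp
  moreover have "U = (@) v ` {w. set w \<subseteq> {..<b} \<and> length w \<le> k}" by (auto simp: U_def)
  ultimately have U: "finite U" by simp
  have "v \<in> U" by (auto simp: U_def)
  have fU: "f z = 0" if "z \<notin> U" for z
    using that a(3) by (auto simp: f_def U_def)
  \<comment> \<open>The pattern is finite and \<open>q x < 1\<close> everywhere, so some positive
    constant works initially. It depends on \<open>v\<close> and \<open>x\<close>, but the iteration
    replaces it by \<open>t0\<close>.\<close>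
  define \<epsilon>1 where "\<epsilon>1 = Min ((\<lambda>z. 1 - q x z) ` U)"
  have \<epsilon>1: "0 < \<epsilon>1" 
  proof -
    have "\<epsilon>1 \<in> (\<lambda>z. 1 - q x z) ` U"
      unfolding \<epsilon>1_def using U \<open>v \<in> U\<close> by (intro Min_in) auto
    then show ?thesis using q_less_1[OF x] by auto
  qed
  have init: "q x z \<le> 1 - \<epsilon>1 * f z" for z
  proof (cases "z \<in> U")
    case True
    then have "\<epsilon>1 \<le> 1 - q x z" using U by (auto simp: \<epsilon>1_def)
    moreover have "\<epsilon>1 * f z \<le> \<epsilon>1 * 1" using \<epsilon>1 f1 by (intro mult_left_mono) auto
    ultimately show ?thesis by simp
  qed (simp add: fU)
  have iter: "q x z \<le> 1 - min t0 ((1 + \<delta>) ^ n * \<epsilon>1) * f z" for n z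
  proof (induction n arbitrary: z)
    case 0
    have "min t0 \<epsilon>1 * f z \<le> \<epsilon>1 * f z" using f0 by (intro mult_right_mono) auto
    then show ?case using init[of z] by simp
  next
    case (Suc n)
    let ?e = "min t0 ((1 + \<delta>) ^ n * \<epsilon>1)"
    have "q x z \<le> 1 - (1 + \<delta>) * ?e * f z"
      using t0 \<epsilon>1 \<delta> by (intro improve Suc) auto
    moreover have "min t0 ((1 + \<delta>) ^ Suc n * \<epsilon>1) \<le> (1 + \<delta>) * ?e"
    proof (cases "t0 \<le> (1 + \<delta>) ^ n * \<epsilon>1")
      case True
      moreover have "t0 \<le> (1 + \<delta>) * t0" using \<delta> t0 by simp
      ultimately show ?thesis by (simp add: min_def)
    qed (simp add: min_def mult_ac)
    then have "min t0 ((1 + \<delta>) ^ Suc n * \<epsilon>1) * f z \<le> (1 + \<delta>) * ?e * f z"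
      using f0 by (rule mult_right_mono)
    ultimately show ?case by linarith
  qed
  obtain n where "t0 / \<epsilon>1 < (1 + \<delta>) ^ n"
    using real_arch_pow[of "1 + \<delta>" "t0 / \<epsilon>1"] \<delta> by auto
  then have "t0 \<le> (1 + \<delta>) ^ n * \<epsilon>1" using \<epsilon>1 by (simp add: field_simps)
  then show ?thesis
    using iter[of v n] f_app[of "[]"] by (simp add: min_def)
qed

text \<open>With at most \<open>lam\<close> children everywhere the walk is recurrent; the barrier \<open>2 j / L - (j / L)\<^sup>2\<close>
  is strictly superharmonic on the levels \<open>0 < j < L\<close>.\<close>

lemma q_le_root:
  assumes kappa_le: "\<And>y. real (\<kappa> y) \<le> lam"
  shows "q x y \<le> q x []"
proof -
  have bound: "q x y - q x [] \<le> 2 * real (length y) / real L" if L: "0 < L" for L :: nat and y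
  proof -
    define u where "u j = (if j \<le> L then 2 * real j / L - (real j / L)\<^sup>2 else 1)" for j
    have L0: "0 < real L" using L by simp
    have u_le: "u j \<le> 2 * real j / L" for j
      using L0 by (auto simp: u_def field_simps)
    have u_ge: "u j = 1" if "L \<le> j" for j
      using that L0 by (auto simp: u_def)
    have u_0: "u 0 = 0" by (simp add: u_def)
    have u_mono: "u j \<le> u (Suc j)" for j
    proof (cases "Suc j \<le> L")
      case True
      then have "u (Suc j) - u j = (2 * (real L - real j) - 1) / L\<^sup>2"
        using L0 by (simp add: u_def field_simps power2_eq_square)
      also have "\<dots> \<ge> 0" using True by (intro divide_nonneg_nonneg) auto
      finally show ?thesis by simp
    next
      case False
      then show ?thesis using u_ge[of j] u_ge[of "Suc j"] by simp
    qed
    have u_concave: "(u j + u (Suc (Suc j))) / 2 = u (Suc j) - 1 / L\<^sup>2" if "Suc j < L" for j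
      using that L0 by (simp add: u_def field_simps power2_eq_square)
    \<comment> \<open>A maximum principle: \<open>g\<close> is not positive at the root or from
      level \<open>L\<close> on, and in between the strict drift of \<open>u\<close> gives
      \<open>S \<le> max 0 (S - 1 / L\<^sup>2)\<close> for the supremum \<open>S\<close> of its
      positive part, hence \<open>S = 0\<close>.\<close>
    define g where "g y = q x y - q x [] - u (length y)" for y
    have g_le: "g y \<le> 1" for y
    proof -
      have "0 \<le> u j" for j using lift_Suc_mono_le[of u 0 j] u_mono u_0 by simp
      then show ?thesis using avoid_prob_le_1[of \<kappa> lam \<mu> UNIV x y] avoid_prob_nonneg[of \<kappa> lam \<mu> UNIV x "[]"]
        unfolding g_def by (smt (verit))
    qed
    define S where "S = (SUP y. max 0 (g y))"
    have bdd: "bdd_above (range (\<lambda>y. max 0 (g y)))"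
      by (rule bdd_aboveI2[where M = 1]) (simp add: g_le)
    have S_upper: "max 0 (g y) \<le> S" for y unfolding S_def by (rule cSUP_upper[OF _ bdd]) simp
    have S0: "0 \<le> S" using S_upper[of "[]"] by simp
    have step: "g y \<le> max 0 (S - 1 / L\<^sup>2)" for y
    proof (cases "y = [] \<or> L \<le> length y")
      case True
      moreover have "q x y - q x [] \<le> 1"
        using avoid_prob_le_1[of \<kappa> lam \<mu> UNIV x y] avoid_prob_nonneg[of \<kappa> lam \<mu> UNIV x "[]"]
        by linarith
      ultimately have "g y \<le> 0"
        using u_0 u_ge[of "length y"] by (auto simp: g_def)
      then show ?thesis by simp
    next
      case False
      then obtain z i where y: "y = z @ [i]" by (cases y rule: rev_cases) auto
      let ?j = "length z" and ?k = "real (\<kappa> y)"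
      have k: "0 < ?k" "?k \<le> lam" using kappa_pos[of y] kappa_le[of y] by auto
      have Pu: "P (\<lambda>y. u (length y)) y = (lam * u ?j + ?k * u (Suc (Suc ?j))) / (lam + ?k)"
        by (simp add: P_step y)
      \<comment> \<open>Since \<open>?k \<le> lam\<close>, at least half of the weight goes to the
        parent, where the increasing \<open>u\<close> is smaller; the symmetric average is therefore
        an upper bound.\<close>
      have "(lam - ?k) * u ?j \<le> (lam - ?k) * u (Suc (Suc ?j))"
        using u_mono[of ?j] u_mono[of "Suc ?j"] k by (intro mult_left_mono) auto
      then have "P (\<lambda>y. u (length y)) y \<le> (u ?j + u (Suc (Suc ?j))) / 2"
        unfolding Pu using k lam_pos by (simp add: field_simps)
      also have "\<dots> = u (length y) - 1 / L\<^sup>2"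
        using u_concave[of ?j] False by (simp add: y)
      finally have Pu_le: "P (\<lambda>y. u (length y)) y \<le> u (length y) - 1 / L\<^sup>2" .
      have "P g y \<le> P (\<lambda>_. S) y" using S_upper by (intro P_mono) simp
      moreover have "P g y = P (q x) y - q x [] - P (\<lambda>y. u (length y)) y"
        unfolding g_def by (simp add: P_diff)
      ultimately have "g y \<le> S - 1 / L\<^sup>2"
        using q_le_P[of x y] Pu_le by (simp add: g_def)
      then show ?thesis by simp
    qed
    have "S \<le> max 0 (S - 1 / L\<^sup>2)"
      unfolding S_def by (rule cSUP_least) (use step in \<open>auto simp: S_def\<close>)
    moreover have "0 < 1 / (real L)\<^sup>2" using L0 by simp
    ultimately have "S = 0" using S0 by (simp add: max_def split: if_splits)
    then have "g y \<le> 0" using S_upper[of y] by simp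
    then show ?thesis using u_le[of "length y"] by (simp add: g_def)
  qed
  \<comment> \<open>Letting the outer level tend to infinity removes the barrier.\<close>
  have "(\<lambda>L. 2 * real (length y) / real (Suc L)) \<longlonglongrightarrow> 0"
    using LIMSEQ_Suc[OF lim_const_over_n[of "2 * real (length y)"]] by simp
  moreover have "q x y - q x [] \<le> 2 * real (length y) / real (Suc L)" for L
    by (rule bound) simp
  ultimately have "q x y - q x [] \<le> 0"
    by (intro LIMSEQ_le_const) blast+
  then show ?thesis by simp
qed

text \<open>The supremum of \<open>q x\<close> is attained at the root, where it is below 1.\<close>

lemma recurrent_if_kappa_le:
  assumes "\<And>y. real (\<kappa> y) \<le> lam" and x: "in_tree \<kappa> x"
  shows "brw_alpha \<kappa> lam \<mu> x = 1"
proof (rule brw_alpha_eq_1, rule q_eq_0)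
  show "0 < 1 - q x []" using q_less_1[OF x, of "[]"] by simp
  show "q x y \<le> 1 - (1 - q x [])" for y using q_le_root[OF assms(1), of x y] by simp
qed

end

section \<open>Hitting good vertices\<close>

text \<open>Random discrete laws are treated through their point weights, which avoids a measurable
  structure on the space of laws.\<close>

lemma measurable_pmf_bind:
  fixes N :: "'a \<Rightarrow> 'b::countable pmf" and f :: "'a \<Rightarrow> 'b \<Rightarrow> 'c pmf"
  assumes N: "\<And>x. (\<lambda>\<omega>. ennreal (pmf (N \<omega>) x)) \<in> borel_measurable M"
    and f: "\<And>x. (\<lambda>\<omega>. ennreal (pmf (f \<omega> x) i)) \<in> borel_measurable M"
  shows "(\<lambda>\<omega>. ennreal (pmf (bind_pmf (N \<omega>) (f \<omega>)) i)) \<in> borel_measurable M"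
  unfolding ennreal_pmf_bind nn_integral_measure_pmf
  by (rule borel_measurable_nn_integral_count_space) (intro borel_measurable_times_ennreal N f)

section \<open>The walk stopped at a level\<close>

definition stop_step :: "(nat list \<Rightarrow> nat) \<Rightarrow> real \<Rightarrow> nat \<Rightarrow> nat list \<Rightarrow> nat list pmf" where
  "stop_step \<kappa> lam L y = (if length y < L then lb_step \<kappa> lam y else return_pmf y)"

primrec walk :: "(nat list \<Rightarrow> nat) \<Rightarrow> real \<Rightarrow> nat \<Rightarrow> nat \<Rightarrow> nat list \<Rightarrow> nat list pmf" where
  "walk \<kappa> lam L 0 y = return_pmf y"
| "walk \<kappa> lam L (Suc n) y = bind_pmf (walk \<kappa> lam L n y) (stop_step \<kappa> lam L)"

lemma lb_step_cong: "\<kappa> y = \<kappa>' y \<Longrightarrow> lb_step \<kappa> lam y = lb_step \<kappa>' lam y"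
  by (simp only: lb_step_def)

text \<open>The stopped walk never reads an offspring number from level \<open>L\<close> on, so the
  tree below its stopping place is fresh.\<close>

lemma walk_cong:
  assumes "\<And>w. length w < L \<Longrightarrow> \<kappa> w = \<kappa>' w"
  shows "walk \<kappa> lam L n y = walk \<kappa>' lam L n y"
proof -
  have "stop_step \<kappa> lam L = stop_step \<kappa>' lam L"
    by (auto simp: stop_step_def fun_eq_iff intro!: lb_step_cong assms)
  then show ?thesis by (induction n) simp_all
qed

lemma measurable_lb_step:
  "(\<lambda>\<kappa>. ennreal (pmf (lb_step \<kappa> lam y) z)) \<in> borel_measurable (genealogies p)"
proof -
  have "(\<lambda>\<kappa>. ennreal (pmf (lb_step (\<lambda>_. \<kappa> y) lam y) z)) \<in> borel_measurable (genealogies p)"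
    by (rule measurable_compose[OF measurable_PiM_pmf_component, where g = "\<lambda>a. ennreal (pmf (lb_step (\<lambda>_. a) lam y) z)"])
       simp
  moreover have "lb_step (\<lambda>_. \<kappa> y) lam y = lb_step \<kappa> lam y" for \<kappa>
    by (rule lb_step_cong) simp
  ultimately show ?thesis by simp
qed

lemma measurable_walk:
  "(\<lambda>\<kappa>. ennreal (pmf (walk \<kappa> lam L n y) z)) \<in> borel_measurable (genealogies p)"
proof (induction n arbitrary: z)
  case (Suc n)
  have "(\<lambda>\<kappa>. ennreal (pmf (stop_step \<kappa> lam L v) z)) \<in> borel_measurable (genealogies p)" for v
    by (cases "length v < L") (simp_all add: stop_step_def measurable_lb_step)
  then show ?case
    unfolding walk.simps by (intro measurable_pmf_bind Suc)
qed simp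

context biased_walk
begin

lemma nn_integral_lb_step:
  assumes "\<And>z. 0 \<le> f z"
  shows "(\<integral>\<^sup>+z. ennreal (f z) \<partial>measure_pmf (lb_step \<kappa> lam y)) = ennreal (P f y)"
  unfolding P_def by (rule nn_integral_eq_integral[OF integrable_lb_step]) (simp add: assms)

lemma subharmonic_walk:
  assumes h0: "\<And>z. 0 \<le> h z" and h: "\<And>z. h z \<le> P h z"
  shows "ennreal (h y) \<le> (\<integral>\<^sup>+z. ennreal (h z) \<partial>measure_pmf (walk \<kappa> lam L n y))"
proof (induction n)
  case (Suc n)
  have "ennreal (h y) \<le> (\<integral>\<^sup>+z. ennreal (h z) \<partial>measure_pmf (walk \<kappa> lam L n y))" by (rule Suc)
  also have "\<dots> \<le> (\<integral>\<^sup>+z. \<integral>\<^sup>+v. ennreal (h v) \<partial>measure_pmf (stop_step \<kappa> lam L z) \<partial>measure_pmf (walk \<kappa> lam L n y))"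
  proof (rule nn_integral_mono)
    fix z
    show "ennreal (h z) \<le> (\<integral>\<^sup>+v. ennreal (h v) \<partial>measure_pmf (stop_step \<kappa> lam L z))"
      by (auto simp: stop_step_def nn_integral_lb_step h0 intro: ennreal_leI h)
  qed
  finally show ?case by simp
qed (simp add: h0)

text \<open>The Lyapunov function \<open>A ^ L - A ^ length y\<close> decreases by at least 1 in the mean below level \<open>L\<close>.\<close>

lemma walk_not_absorbed:
  assumes A_def: "A = 2 * (1 + lam)"
  shows "emeasure (measure_pmf (walk \<kappa> lam L n y)) {z. length z < L} \<le> ennreal ((1 - 1 / A ^ L) ^ n * A ^ L)"
proof -
  have A2: "2 \<le> A" using lam_pos by (simp add: A_def)
  have AL: "1 \<le> A ^ L" using A2 by (intro one_le_power) auto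
  define \<psi> where "\<psi> z = (if length z < L then A ^ L - A ^ length z else 0)" for z :: "nat list"
  have \<psi>_le: "\<psi> z \<le> A ^ L" for z using A2 by (simp add: \<psi>_def)
  have \<psi>_ge: "1 \<le> \<psi> z" if "length z < L" for z
  proof -
    have "2 * A ^ length z \<le> A * A ^ length z" using A2 by (intro mult_right_mono) auto
    also have "\<dots> = A ^ Suc (length z)" by simp
    also have "\<dots> \<le> A ^ L" using that A2 by (intro power_increasing) auto
    finally have "A ^ length z \<le> A ^ L - A ^ length z" by simp
    moreover have "1 \<le> A ^ length z" using A2 by (intro one_le_power) auto
    ultimately show ?thesis using that by (simp add: \<psi>_def)
  qed
  have \<psi>0: "0 \<le> \<psi> z" for z using \<psi>_ge[of z] by (cases "length z < L") (auto simp: \<psi>_def)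
  have P\<psi>: "P \<psi> z \<le> (1 - 1 / A ^ L) * \<psi> z" if z: "length z < L" for z
  proof -
    let ?j = "length z"
    \<comment> \<open>On level \<open>L\<close> the formula yields 0, which is the value
      \<open>\<psi>\<close> has there.\<close>
    have "\<psi> (z @ [i]) = A ^ L - A * A ^ ?j" for i
      using z by (cases "Suc ?j = L") (auto simp: \<psi>_def)
    then have children: "(\<Sum>i<\<kappa> z. \<psi> (z @ [i])) = \<kappa> z * (A ^ L - A * A ^ ?j)" by simp
    have k: "1 \<le> real (\<kappa> z)" using kappa_pos[of z] by simp
    have Aj: "1 \<le> A ^ ?j" using A2 by (intro one_le_power) auto
    have "P \<psi> z \<le> A ^ L - 2 * A ^ ?j"
    proof (cases "z = []")
      case True
      then show ?thesis using children k A2 by (simp add: P_Nil)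
    next
      case False
      have "P \<psi> z \<le> (lam * A ^ L + \<kappa> z * (A ^ L - A * A ^ ?j)) / (lam + \<kappa> z)"
        unfolding P_step[OF False] children
        using lam_pos \<psi>_le by (intro divide_right_mono add_right_mono mult_left_mono) auto
      also have "\<dots> = A ^ L - \<kappa> z * A / (lam + \<kappa> z) * A ^ ?j"
        using lam_pos k by (simp add: field_simps)
      also have "\<dots> \<le> A ^ L - 2 * A ^ ?j"
      proof -
        \<comment> \<open>The choice of \<open>A\<close> makes this work for every degree at least
          1, so the absorption bound is uniform in the environment.\<close>
        have "lam * 1 \<le> lam * \<kappa> z" using lam_pos k by (intro mult_left_mono) auto
        then have "2 * (lam + \<kappa> z) \<le> \<kappa> z * A" by (simp add: A_def algebra_simps)
        then have "2 \<le> \<kappa> z * A / (lam + \<kappa> z)" using lam_pos k by (simp add: pos_le_divide_eq)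
        then have "2 * A ^ ?j \<le> \<kappa> z * A / (lam + \<kappa> z) * A ^ ?j" using Aj by (intro mult_right_mono) auto
        then show ?thesis by simp
      qed
      finally show ?thesis .
    qed
    also have "\<dots> \<le> \<psi> z - 1" using z Aj by (simp add: \<psi>_def)
    \<comment> \<open>As \<open>\<psi> \<le> A ^ L\<close>, a decrease by 1 is a decrease by a fixed
      proportion, and geometric decay follows.\<close>
    also have "\<dots> \<le> \<psi> z - \<psi> z / A ^ L" using \<psi>_le[of z] AL by (simp add: divide_le_eq)
    finally show ?thesis by (simp add: algebra_simps)
  qed
  have r: "0 \<le> 1 - 1 / A ^ L" using AL by (simp add: divide_le_eq)
  have step: "(\<integral>\<^sup>+v. ennreal (\<psi> v) \<partial>measure_pmf (stop_step \<kappa> lam L z)) \<le> ennreal (1 - 1 / A ^ L) * ennreal (\<psi> z)" for z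
  proof (cases "length z < L")
    case True
    then show ?thesis
      using P\<psi>[OF True] r by (simp add: stop_step_def nn_integral_lb_step \<psi>0 ennreal_mult'[symmetric] ennreal_leI)
  next
    case False
    then have "\<psi> z = 0" by (simp add: \<psi>_def)
    then show ?thesis using False by (simp add: stop_step_def)
  qed
  have "(\<integral>\<^sup>+v. ennreal (\<psi> v) \<partial>measure_pmf (walk \<kappa> lam L n y)) \<le> ennreal ((1 - 1 / A ^ L) ^ n * A ^ L)"
  proof (induction n)
    case 0
    then show ?case by (simp add: \<psi>_le ennreal_leI)
  next
    case (Suc n)
    have "(\<integral>\<^sup>+v. ennreal (\<psi> v) \<partial>measure_pmf (walk \<kappa> lam L (Suc n) y)) \<le>
      (\<integral>\<^sup>+z. ennreal (1 - 1 / A ^ L) * ennreal (\<psi> z) \<partial>measure_pmf (walk \<kappa> lam L n y))"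
      by (simp add: nn_integral_mono step)
    also have "\<dots> \<le> ennreal (1 - 1 / A ^ L) * ennreal ((1 - 1 / A ^ L) ^ n * A ^ L)"
      by (simp add: nn_integral_cmult mult_left_mono Suc)
    also have "\<dots> = ennreal ((1 - 1 / A ^ L) ^ Suc n * A ^ L)"
      using r AL by (simp add: ennreal_mult'[symmetric] mult_ac)
    finally show ?case .
  qed
  moreover have "emeasure (measure_pmf (walk \<kappa> lam L n y)) {z. length z < L} \<le>
      (\<integral>\<^sup>+v. ennreal (\<psi> v) \<partial>measure_pmf (walk \<kappa> lam L n y))"
  proof -
    have "(\<integral>\<^sup>+v. indicator {z. length z < L} v \<partial>measure_pmf (walk \<kappa> lam L n y)) \<le>
      (\<integral>\<^sup>+v. ennreal (\<psi> v) \<partial>measure_pmf (walk \<kappa> lam L n y))"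
      by (intro nn_integral_mono) (auto simp: indicator_def \<psi>_ge)
    then show ?thesis by simp
  qed
  ultimately show ?thesis by simp
qed

end

lemma absorption_time_exists:
  assumes "0 < \<tau>" "1 < (A :: real)"
  shows "\<exists>n. (1 - 1 / A ^ L) ^ n * A ^ L \<le> \<tau>"
proof -
  have AL: "1 \<le> A ^ L" using assms by (intro one_le_power) auto
  have "(\<lambda>n. (1 - 1 / A ^ L) ^ n) \<longlonglongrightarrow> 0"
    using AL by (intro LIMSEQ_power_zero) (simp add: divide_le_eq)
  then have "(\<lambda>n. (1 - 1 / A ^ L) ^ n * A ^ L) \<longlonglongrightarrow> 0 * A ^ L"
    by (rule tendsto_mult_right)
  then have "eventually (\<lambda>n. (1 - 1 / A ^ L) ^ n * A ^ L < \<tau>) sequentially"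
    using assms by (intro order_tendstoD(2)) auto
  then show ?thesis by (auto simp: eventually_sequentially intro: less_imp_le)
qed

lemma length_walk_le:
  assumes "length y \<le> L" "z \<in> set_pmf (walk \<kappa> lam L n y)"
  shows "length z \<le> L"
  using assms(2)
proof (induction n arbitrary: z)
  case (Suc n)
  then obtain v where v: "v \<in> set_pmf (walk \<kappa> lam L n y)" "z \<in> set_pmf (stop_step \<kappa> lam L v)"
    by auto
  from v(2) show ?case
  proof (cases "length v < L")
    case True
    with v(2) have "z \<in> set_pmf (lb_step \<kappa> lam v)" by (simp add: stop_step_def)
    then have "z = butlast v \<or> (\<exists>i. z = v @ [i])"
      by (auto simp: lb_step_def split: if_splits)
    then show ?thesis using True by auto
  next
    case False
    with v Suc show ?thesis by (auto simp: stop_step_def)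
  qed
qed (use assms(1) in simp)

text \<open>The walk from \<open>y\<close> observed when it first reaches the levels \<open>length y + J * k\<close>. It is discarded
  (value \<open>None\<close>) at a good vertex, or if it takes more than \<open>N L\<close> steps to reach the next level \<open>L\<close>.\<close>

definition chain_step :: "real \<Rightarrow> nat \<Rightarrow> nat \<Rightarrow> (nat \<Rightarrow> nat) \<Rightarrow> (nat \<Rightarrow> nat) \<Rightarrow> nat \<Rightarrow> (nat list \<Rightarrow> nat) \<Rightarrow>
    nat list option \<Rightarrow> nat list option pmf" where
  "chain_step lam k b c N L \<kappa> s = (case s of None \<Rightarrow> return_pmf None | Some v \<Rightarrow>
     if good k b c \<kappa> v then return_pmf None
     else bind_pmf (walk \<kappa> lam L (N L) v) (\<lambda>z. return_pmf (if length z = L then Some z else None)))"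

primrec chain :: "real \<Rightarrow> nat \<Rightarrow> nat \<Rightarrow> (nat \<Rightarrow> nat) \<Rightarrow> (nat \<Rightarrow> nat) \<Rightarrow> nat list \<Rightarrow> (nat list \<Rightarrow> nat) \<Rightarrow>
    nat \<Rightarrow> nat list option pmf" where
  "chain lam k b c N y \<kappa> 0 = return_pmf (Some y)"
| "chain lam k b c N y \<kappa> (Suc J) =
     bind_pmf (chain lam k b c N y \<kappa> J) (chain_step lam k b c N (length y + Suc J * k) \<kappa>)"

lemma length_chain:
  "Some v \<in> set_pmf (chain lam k b c N y \<kappa> J) \<Longrightarrow> length v = length y + J * k"
  by (cases J) (auto simp: chain_step_def split: option.splits if_splits)

lemma good_cong:
  assumes "\<And>w. length v \<le> length w \<Longrightarrow> length w < length v + k \<Longrightarrow> \<kappa> w = \<kappa>' w"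
  shows "good k b c \<kappa> v \<longleftrightarrow> good k b c \<kappa>' v"
  unfolding good_def using assms by auto

text \<open>Observed levels are \<open>k\<close> apart, the height of the pattern, so a goodness
  test at one level reads nothing from the next level on.\<close>

lemma chain_cong:
  assumes "\<And>w. length w < length y + J * k \<Longrightarrow> \<kappa> w = \<kappa>' w"
  shows "chain lam k b c N y \<kappa> J = chain lam k b c N y \<kappa>' J"
  using assms
proof (induction J)
  case (Suc J)
  have IH: "chain lam k b c N y \<kappa> J = chain lam k b c N y \<kappa>' J"
    by (rule Suc.IH) (use Suc.prems in auto)
  have "walk \<kappa> lam (length y + Suc J * k) n v = walk \<kappa>' lam (length y + Suc J * k) n v" for n v
    by (rule walk_cong) (rule Suc.prems)
  moreover have "good k b c \<kappa> v \<longleftrightarrow> good k b c \<kappa>' v" if "Some v \<in> set_pmf (chain lam k b c N y \<kappa>' J)" for v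
    by (rule good_cong) (use length_chain[OF that] Suc.prems in auto)
  ultimately show ?case
    unfolding chain.simps IH by (intro bind_pmf_cong refl) (auto simp: chain_step_def split: option.splits)
qed simp

lemma measurable_good [measurable]: "Measurable.pred (genealogies p) (\<lambda>\<kappa>. good k b c \<kappa> v)"
  unfolding good_def by measurable

lemma measurable_chain:
  "(\<lambda>\<kappa>. ennreal (pmf (chain lam k b c N y \<kappa> J) s)) \<in> borel_measurable (genealogies p)"
proof (induction J arbitrary: s)
  case (Suc J)
  have "(\<lambda>\<kappa>. ennreal (pmf (chain_step lam k b c N L \<kappa> r) s)) \<in> borel_measurable (genealogies p)" for L r
  proof (cases r)
    case (Some v)
    have [measurable]: "(\<lambda>\<kappa>. ennreal (pmf (bind_pmf (walk \<kappa> lam L (N L) v)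
        (\<lambda>z. return_pmf (if length z = L then Some z else None))) s)) \<in> borel_measurable (genealogies p)"
      by (intro measurable_pmf_bind measurable_walk) simp
    have "(\<lambda>\<kappa>. if good k b c \<kappa> v then ennreal (pmf (return_pmf None) s)
        else ennreal (pmf (bind_pmf (walk \<kappa> lam L (N L) v)
        (\<lambda>z. return_pmf (if length z = L then Some z else None))) s)) \<in> borel_measurable (genealogies p)"
      by measurable
    moreover have "ennreal (pmf (chain_step lam k b c N L \<kappa> r) s) =
        (if good k b c \<kappa> v then ennreal (pmf (return_pmf None) s)
        else ennreal (pmf (bind_pmf (walk \<kappa> lam L (N L) v)
        (\<lambda>z. return_pmf (if length z = L then Some z else None))) s))" for \<kappa>
      by (simp add: chain_step_def Some)
    ultimately show ?thesis by (simp only:)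
  qed (simp add: chain_step_def)
  then show ?case
    unfolding chain.simps by (intro measurable_pmf_bind Suc)
qed simp

section \<open>Survival of the chain and the probability of a good vertex\<close>

definition chain_alive :: "real \<Rightarrow> nat \<Rightarrow> nat \<Rightarrow> (nat \<Rightarrow> nat) \<Rightarrow> (nat \<Rightarrow> nat) \<Rightarrow> nat list \<Rightarrow>
    (nat list \<Rightarrow> nat) \<Rightarrow> nat \<Rightarrow> ennreal" where
  "chain_alive lam k b c N y \<kappa> J = (\<integral>\<^sup>+s. indicator (- {None}) s \<partial>measure_pmf (chain lam k b c N y \<kappa> J))"

lemma measurable_chain_alive:
  "(\<lambda>\<kappa>. chain_alive lam k b c N y \<kappa> J) \<in> borel_measurable (genealogies p)"
  unfolding chain_alive_def nn_integral_measure_pmf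
  by (rule borel_measurable_nn_integral_count_space) (intro borel_measurable_times_ennreal measurable_chain, simp)

definition good_prob :: "nat pmf \<Rightarrow> nat \<Rightarrow> nat \<Rightarrow> (nat \<Rightarrow> nat) \<Rightarrow> real" where
  "good_prob p k b c = (\<Prod>w\<in>{w. set w \<subseteq> {..<b} \<and> length w < k}. pmf p (c (length w)))"

lemma good_prob_le_1: "good_prob p k b c \<le> 1"
  unfolding good_prob_def by (intro prod_le_1) (auto simp: pmf_le_1)

lemma good_prob_pos:
  assumes "\<And>j. j < k \<Longrightarrow> 0 < pmf p (c j)"
  shows "0 < good_prob p k b c"
  unfolding good_prob_def by (intro prod_pos) (auto intro: assms)

lemma nn_integral_not_good:
  "(\<integral>\<^sup>+\<kappa>. indicator {\<kappa>. \<not> good k b c \<kappa> v} \<kappa> \<partial>genealogies p) = ennreal (1 - good_prob p k b c)"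
proof -
  interpret prob_space "genealogies p" by (rule prob_space_PiM_pmf)
  have meas: "{\<kappa>. good k b c \<kappa> v} \<in> events"
    using measurable_good[where p = p and k = k and b = b and c = c and v = v] by (simp add: pred_def)
  define W where "W = {w. set w \<subseteq> {..<b} \<and> length w < k}"
  have fin: "finite W"
    by (rule finite_subset[OF _ finite_lists_length_le[of "{..<b}" k]]) (auto simp: W_def)
  have eq: "indicator {\<kappa>. good k b c \<kappa> v} \<kappa> = (\<Prod>w\<in>W. indicator {c (length w)} (\<kappa> (v @ w)) :: ennreal)" for \<kappa>
  proof (cases "good k b c \<kappa> v")
    case True
    then show ?thesis by (auto simp: good_def W_def indicator_def intro!: prod.neutral[symmetric])
  next
    case False
    then obtain w where "w \<in> W" "\<kappa> (v @ w) \<noteq> c (length w)" by (auto simp: good_def W_def)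
    then have "(\<Prod>w\<in>W. indicator {c (length w)} (\<kappa> (v @ w)) :: ennreal) = 0"
      using fin by (intro prod_zero) (auto intro!: bexI[of _ w])
    then show ?thesis using False by simp
  qed
  have "emeasure (genealogies p) {\<kappa>. good k b c \<kappa> v} =
      (\<integral>\<^sup>+\<kappa>. (\<Prod>w\<in>W. indicator {c (length w)} (\<kappa> (v @ w))) \<partial>genealogies p)"
    unfolding eq[symmetric] by (rule nn_integral_indicator[OF meas, symmetric])
  also have "\<dots> = (\<Prod>w\<in>W. \<integral>\<^sup>+\<kappa>. indicator {c (length w)} (\<kappa> (v @ w)) \<partial>genealogies p)"
  proof (rule nn_integral_prod_PiM_pmf[OF fin, where B = "\<lambda>w. {v @ w}"])
    show "(\<lambda>\<kappa>. indicator {c (length w)} (\<kappa> (v @ w)) :: ennreal) \<in> borel_measurable (genealogies p)" for w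
      by (rule measurable_compose[OF measurable_PiM_pmf_component]) simp
  qed (auto simp: disjoint_family_on_def)
  also have "\<dots> = (\<Prod>w\<in>W. ennreal (pmf p (c (length w))))"
    by (subst nn_integral_PiM_pmf_component) (simp add: emeasure_pmf_single)
  also have "\<dots> = ennreal (good_prob p k b c)"
    by (simp add: good_prob_def W_def prod_ennreal)
  finally have good: "prob {\<kappa>. good k b c \<kappa> v} = good_prob p k b c"
    by (simp add: emeasure_eq_measure good_prob_def prod_nonneg)
  have "{\<kappa>. \<not> good k b c \<kappa> v} = space (genealogies p) - {\<kappa>. good k b c \<kappa> v}" by auto
  then have "prob {\<kappa>. \<not> good k b c \<kappa> v} = 1 - good_prob p k b c" "{\<kappa>. \<not> good k b c \<kappa> v} \<in> events"
    using prob_compl[OF meas] good sets.compl_sets[OF meas] by auto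
  then show ?thesis by (simp add: emeasure_eq_measure)
qed

text \<open>Whether the chain survives up to level \<open>length y + J * k\<close> is decided above that level, whereas goodness
  of the vertex reached there is decided below it.\<close>

lemma chain_alive_Suc:
  "(\<integral>\<^sup>+\<kappa>. chain_alive lam k b c N y \<kappa> (Suc J) \<partial>genealogies p) \<le>
    ennreal (1 - good_prob p k b c) * (\<integral>\<^sup>+\<kappa>. chain_alive lam k b c N y \<kappa> J \<partial>genealogies p)"
proof -
  let ?r = "ennreal (1 - good_prob p k b c)" and ?G = "genealogies p"
  let ?Z = "\<lambda>\<kappa> s. ennreal (pmf (chain lam k b c N y \<kappa> J) s)"
  define bad :: "nat list option \<Rightarrow> (nat list \<Rightarrow> nat) \<Rightarrow> ennreal"
    where "bad s \<kappa> = (case s of None \<Rightarrow> 0 | Some v \<Rightarrow> indicator {\<kappa>. \<not> good k b c \<kappa> v} \<kappa>)" for s \<kappa>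
  have bad_meas [measurable]: "bad s \<in> borel_measurable ?G" for s
    unfolding bad_def by (cases s) simp_all
  note [measurable] = measurable_chain
  \<comment> \<open>To survive one more level the current vertex must not be good; the chance of
    running out of time is simply dropped.\<close>
  have le: "chain_alive lam k b c N y \<kappa> (Suc J) \<le> (\<integral>\<^sup>+s. ?Z \<kappa> s * bad s \<kappa> \<partial>count_space UNIV)" for \<kappa>
  proof -
    have "(\<integral>\<^sup>+r. indicator (- {None}) r \<partial>measure_pmf (chain_step lam k b c N L \<kappa> s)) \<le> bad s \<kappa>" for s L
    proof (cases s)
      case (Some v)
      have "(\<integral>\<^sup>+r. indicator (- {None}) r \<partial>measure_pmf (chain_step lam k b c N L \<kappa> s)) \<le> 1"
        using measure_pmf.emeasure_le_1 by (simp add: measure_pmf.emeasure_eq_measure)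
      then show ?thesis
        by (cases "good k b c \<kappa> v") (simp_all add: bad_def Some chain_step_def)
    qed (simp add: chain_step_def bad_def)
    then have "chain_alive lam k b c N y \<kappa> (Suc J) \<le> (\<integral>\<^sup>+s. bad s \<kappa> \<partial>measure_pmf (chain lam k b c N y \<kappa> J))"
      unfolding chain_alive_def chain.simps nn_integral_bind_pmf by (intro nn_integral_mono)
    then show ?thesis by (simp only: nn_integral_measure_pmf)
  qed
  have indep: "(\<integral>\<^sup>+\<kappa>. ?Z \<kappa> s * bad s \<kappa> \<partial>?G) \<le> ?r * (\<integral>\<^sup>+\<kappa>. ?Z \<kappa> s * indicator (- {None}) s \<partial>?G)" for s
  proof (cases s)
    case None
    then show ?thesis by (simp add: bad_def)
  next
    case (Some v)
    show ?thesis
    proof (cases "length v = length y + J * k")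
      case True
      have "(\<integral>\<^sup>+\<kappa>. ?Z \<kappa> s * bad s \<kappa> \<partial>?G) = (\<integral>\<^sup>+\<kappa>. ?Z \<kappa> s \<partial>?G) * (\<integral>\<^sup>+\<kappa>. bad s \<kappa> \<partial>?G)"
      proof (rule nn_integral_mult_PiM_pmf[where A = "{w. length w < length v}" and B = "{w. length v \<le> length w}"])
        fix \<kappa> \<kappa>' :: "nat list \<Rightarrow> nat"
        assume "\<And>w. w \<in> {w. length w < length v} \<Longrightarrow> \<kappa> w = \<kappa>' w"
        then have "chain lam k b c N y \<kappa> J = chain lam k b c N y \<kappa>' J"
          using True by (intro chain_cong) auto
        then show "?Z \<kappa> s = ?Z \<kappa>' s" by simp
      next
        fix \<kappa> \<kappa>' :: "nat list \<Rightarrow> nat"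
        assume "\<And>w. w \<in> {w. length v \<le> length w} \<Longrightarrow> \<kappa> w = \<kappa>' w"
        then have "good k b c \<kappa> v \<longleftrightarrow> good k b c \<kappa>' v" by (intro good_cong) auto
        then show "bad s \<kappa> = bad s \<kappa>'" by (simp add: bad_def Some indicator_def)
      qed (simp_all only: measurable_chain bad_meas, auto)
      also have "(\<integral>\<^sup>+\<kappa>. bad s \<kappa> \<partial>?G) = ?r" using nn_integral_not_good[where p = p and k = k and b = b and c = c and v = v] by (simp add: bad_def Some)
      finally show ?thesis by (simp add: Some mult.commute)
    next
      case False
      then have "?Z \<kappa> s = 0" for \<kappa>
        using length_chain[of v lam k b c N y \<kappa> J] by (auto simp: Some pmf_eq_0_set_pmf)
      then show ?thesis by simp
    qed
  qed
  have "(\<integral>\<^sup>+\<kappa>. chain_alive lam k b c N y \<kappa> (Suc J) \<partial>?G) \<le> (\<integral>\<^sup>+\<kappa>. \<integral>\<^sup>+s. ?Z \<kappa> s * bad s \<kappa> \<partial>count_space UNIV \<partial>?G)"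
    by (intro nn_integral_mono le)
  also have "\<dots> = (\<integral>\<^sup>+s. \<integral>\<^sup>+\<kappa>. ?Z \<kappa> s * bad s \<kappa> \<partial>?G \<partial>count_space UNIV)"
    by (rule nn_integral_count_space_nn_integral) auto
  also have "\<dots> \<le> (\<integral>\<^sup>+s. ?r * (\<integral>\<^sup>+\<kappa>. ?Z \<kappa> s * indicator (- {None}) s \<partial>?G) \<partial>count_space UNIV)"
    by (intro nn_integral_mono indep)
  also have "\<dots> = ?r * (\<integral>\<^sup>+s. \<integral>\<^sup>+\<kappa>. ?Z \<kappa> s * indicator (- {None}) s \<partial>?G \<partial>count_space UNIV)"
    by (rule nn_integral_cmult) simp
  also have "(\<integral>\<^sup>+s. \<integral>\<^sup>+\<kappa>. ?Z \<kappa> s * indicator (- {None}) s \<partial>?G \<partial>count_space UNIV) =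
      (\<integral>\<^sup>+\<kappa>. \<integral>\<^sup>+s. ?Z \<kappa> s * indicator (- {None}) s \<partial>count_space UNIV \<partial>?G)"
    by (rule nn_integral_count_space_nn_integral[symmetric]) auto
  also have "\<dots> = (\<integral>\<^sup>+\<kappa>. chain_alive lam k b c N y \<kappa> J \<partial>?G)"
    unfolding chain_alive_def nn_integral_measure_pmf ..
  finally show ?thesis .
qed

text \<open>Each level is survived with mean factor at most
  \<open>1 - good_prob p k b c < 1\<close>, so the mean survival decays geometrically and its
  infimum has mean 0.\<close>

lemma AE_chain_dies:
  assumes "\<And>j. j < k \<Longrightarrow> 0 < pmf p (c j)"
  shows "AE \<kappa> in genealogies p. (INF J. chain_alive lam k b c N y \<kappa> J) = 0"
proof -
  interpret prob_space "genealogies p" by (rule prob_space_PiM_pmf)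
  let ?G = "genealogies p" and ?r = "1 - good_prob p k b c"
  have r: "0 \<le> ?r" "?r < 1" using good_prob_pos[OF assms] good_prob_le_1 by auto
  have le: "(\<integral>\<^sup>+\<kappa>. chain_alive lam k b c N y \<kappa> J \<partial>?G) \<le> ennreal (?r ^ J)" for J
  proof (induction J)
    case 0
    show ?case using emeasure_space_1 by (simp add: chain_alive_def)
  next
    case (Suc J)
    have "(\<integral>\<^sup>+\<kappa>. chain_alive lam k b c N y \<kappa> (Suc J) \<partial>?G) \<le> ennreal ?r * (\<integral>\<^sup>+\<kappa>. chain_alive lam k b c N y \<kappa> J \<partial>?G)"
      by (rule chain_alive_Suc)
    also have "\<dots> \<le> ennreal ?r * ennreal (?r ^ J)"
      by (intro mult_left_mono Suc) simp
    finally show ?case using r by (simp add: ennreal_mult'[symmetric])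
  qed
  have "(\<integral>\<^sup>+\<kappa>. (INF J. chain_alive lam k b c N y \<kappa> J) \<partial>?G) \<le> ennreal (?r ^ J)" for J
    by (rule order_trans[OF nn_integral_mono le]) (rule INF_lower, simp)
  moreover have "(\<lambda>J. ennreal (?r ^ J)) \<longlonglongrightarrow> ennreal 0"
    using r by (intro tendsto_ennrealI LIMSEQ_power_zero) auto
  ultimately have "(\<integral>\<^sup>+\<kappa>. (INF J. chain_alive lam k b c N y \<kappa> J) \<partial>?G) \<le> ennreal 0"
    by (intro LIMSEQ_le_const) blast+
  then have "(\<integral>\<^sup>+\<kappa>. (INF J. chain_alive lam k b c N y \<kappa> J) \<partial>?G) = 0" by simp
  then show ?thesis
    by (subst (asm) nn_integral_0_iff_AE) (auto intro!: borel_measurable_INF measurable_chain_alive)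
qed

text \<open>Follow \<open>h\<close> along the chain: discarding at good vertices costs nothing since
  \<open>h\<close> vanishes there, running out of time before level \<open>L\<close> costs at most
  \<open>e * (1 / 2) ^ L\<close>, and the surviving mass tends to 0 along some levels. The total
  loss is at most \<open>e\<close>.\<close>

lemma (in biased_walk) subharmonic_le_chain:
  fixes e :: real
  assumes h0: "\<And>z. 0 \<le> h z" and h1: "\<And>z. h z \<le> 1" and sub: "\<And>z. h z \<le> P h z"
    and good: "\<And>v. good k b c \<kappa> v \<Longrightarrow> h v = 0"
    and k: "0 < k" and e: "0 \<le> e" and A: "A = 2 * (1 + lam)"
    and N: "\<And>L. (1 - 1 / A ^ L) ^ N L * A ^ L \<le> e * (1 / 2) ^ L"
    and dies: "(INF J. chain_alive lam k b c N y \<kappa> J) = 0"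
  shows "h y \<le> e"
proof -
  define H where "H s = (case s of None \<Rightarrow> 0 | Some v \<Rightarrow> ennreal (h v))" for s
  let ?E = "\<lambda>J. \<integral>\<^sup>+s. H s \<partial>measure_pmf (chain lam k b c N y \<kappa> J)"
  have step: "?E J \<le> ?E (Suc J) + ennreal (e * (1 / 2) ^ Suc J)" for J
  proof -
    let ?L = "length y + Suc J * k"
    have "(\<integral>\<^sup>+s. H s \<partial>measure_pmf (chain lam k b c N y \<kappa> J)) \<le>
      (\<integral>\<^sup>+s. (\<integral>\<^sup>+r. H r \<partial>measure_pmf (chain_step lam k b c N ?L \<kappa> s)) + ennreal (e * (1 / 2) ^ Suc J)
        \<partial>measure_pmf (chain lam k b c N y \<kappa> J))"
    proof (rule nn_integral_mono_AE, unfold AE_measure_pmf_iff, rule ballI)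
      fix s assume s: "s \<in> set_pmf (chain lam k b c N y \<kappa> J)"
      show "H s \<le> (\<integral>\<^sup>+r. H r \<partial>measure_pmf (chain_step lam k b c N ?L \<kappa> s)) + ennreal (e * (1 / 2) ^ Suc J)"
      proof (cases "\<exists>v. s = Some v \<and> \<not> good k b c \<kappa> v")
        case False
        then have "H s = 0" by (auto simp: H_def good split: option.splits)
        then show ?thesis by simp
      next
        case True
        then obtain v where v: "s = Some v" "\<not> good k b c \<kappa> v" by blast
        have len: "length v \<le> ?L" using length_chain[of v lam k b c N y \<kappa> J] s v by simp
        let ?W = "walk \<kappa> lam ?L (N ?L) v"
        have "H s \<le> (\<integral>\<^sup>+z. ennreal (h z) \<partial>measure_pmf ?W)"
          using subharmonic_walk[OF h0 sub] by (simp add: H_def v)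
        \<comment> \<open>The walk ends on level \<open>?L\<close> or above it; in the second case
          \<open>h\<close> is bounded by 1 and the probability of running out of time
          remains.\<close>
        also have "\<dots> \<le> (\<integral>\<^sup>+z. H (if length z = ?L then Some z else None) + indicator {z. length z < ?L} z \<partial>measure_pmf ?W)"
        proof (rule nn_integral_mono_AE, unfold AE_measure_pmf_iff, rule ballI)
          fix z assume "z \<in> set_pmf ?W"
          then have "length z \<le> ?L" by (rule length_walk_le[OF len])
          then show "ennreal (h z) \<le> H (if length z = ?L then Some z else None) + indicator {z. length z < ?L} z"
            using h1[of z] by (cases "length z = ?L") (auto simp: H_def)
        qed
        also have "\<dots> = (\<integral>\<^sup>+z. H (if length z = ?L then Some z else None) \<partial>measure_pmf ?W) +
            emeasure (measure_pmf ?W) {z. length z < ?L}"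
          by (simp add: nn_integral_add)
        also have "(\<integral>\<^sup>+z. H (if length z = ?L then Some z else None) \<partial>measure_pmf ?W) =
            (\<integral>\<^sup>+r. H r \<partial>measure_pmf (chain_step lam k b c N ?L \<kappa> s))"
          by (simp add: chain_step_def v)
        also have "emeasure (measure_pmf ?W) {z. length z < ?L} \<le> ennreal (e * (1 / 2) ^ Suc J)"
        proof -
          have "emeasure (measure_pmf ?W) {z. length z < ?L} \<le> ennreal ((1 - 1 / A ^ ?L) ^ N ?L * A ^ ?L)"
            by (rule walk_not_absorbed[OF A])
          also have "\<dots> \<le> ennreal (e * (1 / 2) ^ ?L)" by (intro ennreal_leI N)
          also have "\<dots> \<le> ennreal (e * (1 / 2) ^ Suc J)"
          proof (intro ennreal_leI mult_left_mono power_decreasing e)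
            have "Suc J * 1 \<le> Suc J * k" using k by (intro mult_le_mono2) simp
            then show "Suc J \<le> ?L" by simp
          qed auto
          finally show ?thesis .
        qed
        finally show ?thesis by (simp add: add_left_mono)
      qed
    qed
    also have "\<dots> = ?E (Suc J) + ennreal (e * (1 / 2) ^ Suc J)"
      by (simp add: nn_integral_add)
    finally show ?thesis .
  qed
  \<comment> \<open>The time-out losses of the first \<open>J\<close> steps form a geometric
    sum.\<close>
  have iter: "ennreal (h y) \<le> ?E J + ennreal (e * (1 - (1 / 2) ^ J))" for J
  proof (induction J)
    case 0
    show ?case by (simp add: H_def)
  next
    case (Suc J)
    have "ennreal (h y) \<le> ?E J + ennreal (e * (1 - (1 / 2) ^ J))" by (rule Suc)
    also have "\<dots> \<le> ?E (Suc J) + ennreal (e * (1 / 2) ^ Suc J) + ennreal (e * (1 - (1 / 2) ^ J))"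
      by (intro add_right_mono step)
    also have "\<dots> = ?E (Suc J) + ennreal (e * (1 / 2) ^ Suc J + e * (1 - (1 / 2) ^ J))"
      using e by (simp add: add.assoc ennreal_plus power_le_one del: power_Suc)
    also have "e * (1 / 2) ^ Suc J + e * (1 - (1 / 2) ^ J) = e * (1 - (1 / 2) ^ Suc J)"
      by (simp add: algebra_simps)
    finally show ?case .
  qed
  have alive: "ennreal (h y) \<le> chain_alive lam k b c N y \<kappa> J + ennreal e" for J
  proof -
    have "?E J \<le> chain_alive lam k b c N y \<kappa> J"
      unfolding chain_alive_def
      by (intro nn_integral_mono) (auto simp: H_def h1 split: option.splits)
    moreover have "e * (1 - (1 / 2) ^ J) \<le> e * 1" using e by (intro mult_left_mono) auto
    ultimately have "?E J + ennreal (e * (1 - (1 / 2) ^ J)) \<le> chain_alive lam k b c N y \<kappa> J + ennreal e"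
      by (intro add_mono ennreal_leI) simp_all
    with iter[of J] show ?thesis by (rule order_trans)
  qed
  have "h y \<le> e + e'" if e': "0 < e'" for e'
  proof -
    have "(INF J. chain_alive lam k b c N y \<kappa> J) < ennreal e'" using dies e' by simp
    then obtain J where "chain_alive lam k b c N y \<kappa> J < ennreal e'" by (auto simp: INF_less_iff)
    then have "chain_alive lam k b c N y \<kappa> J + ennreal e \<le> ennreal e' + ennreal e"
      by (intro add_right_mono less_imp_le)
    with alive[of J] have "ennreal (h y) \<le> ennreal e' + ennreal e" by (rule order_trans)
    then show ?thesis using e e' by (simp flip: ennreal_plus)
  qed
  then show ?thesis by (rule field_le_epsilon)
qed

text \<open>The pattern lowers \<open>q x\<close> by \<open>t0 * a 0\<close> at every good vertex.
  Half of this is spent on time-outs, and the other half remains as a gap below 1 at every starting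
  point.\<close>

lemma (in biased_brw) recurrent_if_chain_dies:
  fixes a :: "nat \<Rightarrow> real"
  assumes x: "in_tree \<kappa> x"
    and t0: "0 < t0" "t0 \<le> 1" and pgf: "\<And>t. 0 \<le> t \<Longrightarrow> t \<le> t0 \<Longrightarrow> pgf \<mu> (1 - t) \<le> 1 - m' * t"
    and m': "0 < m'" and \<delta>: "0 < \<delta>"
    and a: "\<And>j. 0 \<le> a j" "\<And>j. a j \<le> 1" "\<And>j. k \<le> j \<Longrightarrow> a j = 0" "0 < a 0"
    and c: "\<And>j. j < k \<Longrightarrow> c j \<le> b"
    and sub: "\<And>j. j < k \<Longrightarrow>
      (1 + \<delta>) * (lam + c j) * a j \<le> m' * (lam * (if j = 0 then 0 else a (j - 1)) + c j * a (Suc j))"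
    and A: "A = 2 * (1 + lam)"
    and N: "\<And>L. (1 - 1 / A ^ L) ^ N L * A ^ L \<le> t0 * a 0 / 2 * (1 / 2) ^ L"
    and dies: "\<And>y. (INF J. chain_alive lam k b c N y \<kappa> J) = 0"
  shows "brw_alpha \<kappa> lam \<mu> x = 1"
proof (rule brw_alpha_eq_1, rule q_eq_0)
  let ?c = "t0 * a 0"
  have c0: "0 < ?c" using t0 a by simp
  have "?c \<le> 1 * 1" using t0 a by (intro mult_mono) auto
  then have c1: "?c \<le> 1" by simp
  have k: "0 < k" using a(3)[of 0] a(4) by (cases k) auto
  show "0 < ?c / 2" using c0 by simp
  fix y
  \<comment> \<open>The excess of \<open>q x\<close> over its bound at good vertices; the positive
    part keeps it subharmonic, nonnegative and zero at good vertices.\<close>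
  define h where "h z = max 0 (q x z - (1 - ?c))" for z
  have "h y \<le> ?c / 2"
  proof (rule subharmonic_le_chain[OF _ _ _ _ k _ A N dies])
    show "0 \<le> h z" "h z \<le> 1" for z
      using avoid_prob_le_1[of \<kappa> lam \<mu> UNIV x z] c1 unfolding h_def by linarith+
    show "h z \<le> P h z" for z
    proof -
      have "P (\<lambda>z. q x z - (1 - ?c)) z \<le> P h z" by (rule P_mono) (simp add: h_def)
      moreover have "P (\<lambda>z. q x z - (1 - ?c)) z = P (q x) z - (1 - ?c)" by (simp only: P_diff P_const)
      moreover have "0 \<le> P h z" by (rule P_nonneg) (simp add: h_def)
      ultimately show ?thesis using q_le_P[of x z] by (simp add: h_def)
    qed
    show "h v = 0" if "good k b c \<kappa> v" for v
      using q_good[OF x that t0 pgf m' \<delta> a(1-3) c sub] by (simp add: h_def)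
  qed (use c0 in auto)
  moreover have "q x y - (1 - ?c) \<le> h y" by (simp add: h_def)
  ultimately show "q x y \<le> 1 - ?c / 2" by linarith
qed

section \<open>Supercritical patterns\<close>

text \<open>A radial strict subeigenvector of the killed walk; the values 0 above level 0 and from
  level \<open>k\<close> on encode the killing. The mean is replaced by \<open>m'\<close> because
  \<open>pgf_upper_bound\<close> provides only slopes below the mean.\<close>

definition supercritical :: "real \<Rightarrow> real \<Rightarrow> real \<Rightarrow> nat \<Rightarrow> (nat \<Rightarrow> nat) \<Rightarrow> (nat \<Rightarrow> real) \<Rightarrow> bool" where
  "supercritical lam m' \<delta> k c a \<longleftrightarrow> 0 < m' \<and> 0 < \<delta> \<and> 0 < a 0 \<and>
     (\<forall>j. 0 \<le> a j \<and> a j \<le> 1) \<and> (\<forall>j\<ge>k. a j = 0) \<and>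
     (\<forall>j<k. (1 + \<delta>) * (lam + c j) * a j \<le>
       m' * (lam * (if j = 0 then 0 else a (j - 1)) + c j * a (Suc j)))"

text \<open>On \<open>k\<close> levels of a \<open>d\<close>-ary tree, \<open>s ^ j * sin (\<theta> (j + 1))\<close> with \<open>s = sqrt (lam / d)\<close> and
  \<open>\<theta> = pi / (k + 1)\<close> is the Perron eigenfunction of the killed walk; its eigenvalue is
  \<open>2 * sqrt (lam * d) / (d + lam) * cos \<theta>\<close>.\<close>

lemma supercritical_regular:
  fixes d :: nat
  assumes lam: "0 < lam" and d: "0 < d" and m: "(real d + lam) / (2 * sqrt (lam * real d)) < m"
  shows "\<exists>m'<m. \<exists>\<delta> k a. supercritical lam m' \<delta> k (\<lambda>_. d) a"
proof -
  define m0 where "m0 = (real d + lam) / (2 * sqrt (lam * real d))"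
  have m0: "0 < m0" "m0 < m" using assms by (auto simp: m0_def intro!: divide_pos_pos)
  \<comment> \<open>Half of the room above the threshold is kept for linearising \<open>pgf\<close>,
    the other half pays for \<open>cos \<theta> < 1\<close> and \<open>\<delta>\<close>.\<close>
  define m' where "m' = (m0 + m) / 2"
  have m': "m0 < m'" "m' < m" "0 < m'" using m0 by (auto simp: m'_def)
  have "(\<lambda>k. pi / real (Suc k)) \<longlonglongrightarrow> 0"
    using LIMSEQ_Suc[OF lim_const_over_n[of pi]] by simp
  then have "(\<lambda>k. m' * cos (pi / real (Suc k))) \<longlonglongrightarrow> m' * cos 0"
    by (intro tendsto_intros)
  then have "eventually (\<lambda>k. m0 < m' * cos (pi / real (Suc k))) sequentially"
    using m' by (intro order_tendstoD(1)) auto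
  then obtain k0 where k0: "\<And>k. k0 \<le> k \<Longrightarrow> m0 < m' * cos (pi / real (Suc k))"
    by (auto simp: eventually_sequentially)
  define k where "k = Suc k0"
  define \<theta> where "\<theta> = pi / real (Suc k)"
  have cos: "m0 < m' * cos \<theta>" unfolding \<theta>_def by (rule k0) (simp add: k_def)
  define \<delta> where "\<delta> = m' * cos \<theta> / m0 - 1"
  have \<delta>: "0 < \<delta>" using cos m0 by (simp add: \<delta>_def)
  define s where "s = sqrt (lam / d)"
  have s: "0 < s" using lam d by (simp add: s_def)
  have lam_s: "lam = d * s\<^sup>2" using lam d by (simp add: s_def)
  have "sqrt (lam * d) = d * s" using d s by (simp add: lam_s real_sqrt_mult)
  then have m0_s: "m0 * (2 * d * s) = d + lam" using d s by (simp add: m0_def)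
  have \<theta>_k: "\<theta> * (real k + 1) = pi" by (simp add: \<theta>_def field_simps)
  have \<theta>: "0 < \<theta>" by (simp add: \<theta>_def)
  define S where "S j = s ^ j * sin (\<theta> * (real j + 1))" for j
  \<comment> \<open>Normalises \<open>a\<close> to at most 1 whether or not \<open>s\<close> exceeds
    1.\<close>
  define C where "C = max 1 s ^ k"
  have C: "0 < C" by (simp add: C_def)
  define a where "a j = (if j < k then S j / C else 0)" for j
  have S0: "0 < S j" if "j < k" for j
  proof -
    have "\<theta> * (real j + 1) < \<theta> * (real k + 1)" using \<theta> that by (intro mult_strict_left_mono) auto
    then have "0 < sin (\<theta> * (real j + 1))" using \<theta> \<theta>_k by (intro sin_gt_zero) auto
    then show ?thesis using s by (simp add: S_def)
  qed
  have S1: "S j \<le> C" if "j < k" for j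
  proof -
    have "S j \<le> s ^ j * 1" unfolding S_def using s by (intro mult_left_mono) auto
    also have "\<dots> \<le> max 1 s ^ j" using s by (simp add: power_mono)
    also have "\<dots> \<le> C" unfolding C_def using that by (intro power_increasing) auto
    finally show ?thesis .
  qed
  \<comment> \<open>At \<open>j = k\<close> the sine vanishes, so the cut-off agrees with the
    eigenfunction on the boundary.\<close>
  have a_le: "a j = S j / C" if "j \<le> k" for j
    using that \<theta>_k by (auto simp: a_def S_def)
  \<comment> \<open>The addition theorem for \<open>sin (\<theta> * j)\<close> and
    \<open>sin (\<theta> * (j + 2))\<close>. At \<open>j = 0\<close> the missing parent term is
    \<open>sin 0\<close>.\<close>
  have eigen: "lam * (if j = 0 then 0 else S (j - 1)) + d * S (Suc j) = 2 * d * s * cos \<theta> * S j" for j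
  proof -
    have "lam * (if j = 0 then 0 else S (j - 1)) = d * s ^ Suc j * sin (\<theta> * real j)"
      by (cases j) (auto simp: S_def lam_s power2_eq_square algebra_simps)
    moreover have "sin (\<theta> * real j) = sin (\<theta> * (real j + 1)) * cos \<theta> - cos (\<theta> * (real j + 1)) * sin \<theta>"
      using sin_diff[of "\<theta> * (real j + 1)" \<theta>] by (simp add: algebra_simps)
    moreover have "sin (\<theta> * (real (Suc j) + 1)) = sin (\<theta> * (real j + 1)) * cos \<theta> + cos (\<theta> * (real j + 1)) * sin \<theta>"
      using sin_add[of "\<theta> * (real j + 1)" \<theta>] by (simp add: algebra_simps)
    ultimately show ?thesis by (simp add: S_def algebra_simps)
  qed
  have "(1 + \<delta>) * (lam + d) * a j \<le> m' * (lam * (if j = 0 then 0 else a (j - 1)) + d * a (Suc j))"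
    if j: "j < k" for j
  proof -
    have "m' * (lam * (if j = 0 then 0 else a (j - 1)) + d * a (Suc j)) =
        m' * (lam * (if j = 0 then 0 else S (j - 1)) + d * S (Suc j)) / C"
      using j a_le[of "j - 1"] a_le[of "Suc j"] by (simp add: add_divide_distrib distrib_left)
    also have "\<dots> = (m' * cos \<theta>) * (2 * d * s) * a j"
      unfolding eigen using a_le[of j] j by simp
    also have "m' * cos \<theta> = (1 + \<delta>) * m0" using m0 by (simp add: \<delta>_def)
    also have "(1 + \<delta>) * m0 * (2 * d * s) = (1 + \<delta>) * (lam + d)"
      using m0_s by (simp add: mult.assoc)
    finally show ?thesis by simp
  qed
  moreover have "0 \<le> a j \<and> a j \<le> 1" for j
    using S0[of j] S1[of j] C by (auto simp: a_def divide_le_eq)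
  moreover have "0 < a 0" using S0[of 0] C by (simp add: a_def k_def)
  ultimately have "supercritical lam m' \<delta> k (\<lambda>_. d) a"
    using \<delta> m' by (auto simp: supercritical_def a_def)
  then show ?thesis using m' by blast
qed

text \<open>A trap: \<open>k\<close> levels with \<open>K > lam\<close> children push the walk down, the levels below with \<open>d < lam\<close>
  children push it up.\<close>

lemma supercritical_trap:
  fixes d K :: nat
  assumes d: "0 < d" "real d < lam" and K: "lam < real K" and m: "1 < m"
  shows "\<exists>m'<m. \<exists>\<delta> k a n. supercritical lam m' \<delta> k (\<lambda>j. if j < n then K else d) a"
proof -
  have lam: "0 < lam" using d by simp
  define m' where "m' = (1 + m) / 2"
  have m': "1 < m'" "m' < m" using m by (auto simp: m'_def)
  define \<delta> where "\<delta> = (m' - 1) / 2"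
  have \<delta>: "0 < \<delta>" "1 + \<delta> < m'" using m' by (auto simp: \<delta>_def field_simps)
  \<comment> \<open>A common decay rate for both halves: \<open>t\<close> to the distance from the
    killing boundary is superharmonic wherever the drift points away from it.\<close>
  define t where "t = max (lam / K) (d / lam)"
  have t: "0 < t" "t < 1" "lam \<le> K * t" "d \<le> lam * t"
    using assms lam by (auto simp: t_def less_max_iff_disj field_simps le_max_iff_disj max_mult_distrib_left)
  have "(\<lambda>n. m' * (1 - t ^ n)) \<longlonglongrightarrow> m' * (1 - 0)"
    using t by (intro tendsto_intros LIMSEQ_power_zero) auto
  then have "eventually (\<lambda>n. 1 + \<delta> < m' * (1 - t ^ n)) sequentially"
    using \<delta> by (intro order_tendstoD(1)) auto
  then obtain n0 where n0: "\<And>n. n0 \<le> n \<Longrightarrow> 1 + \<delta> < m' * (1 - t ^ n)"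
    by (auto simp: eventually_sequentially)
  define n where "n = Suc n0"
  have n: "1 + \<delta> < m' * (1 - t ^ n)" by (rule n0) (simp add: n_def)
  \<comment> \<open>One minus \<open>t\<close> to the distance from the nearer killed level, -1 or
    \<open>2 * n + 1\<close>. It is subharmonic except at the peak \<open>n\<close>, where the
    deficit is small for large \<open>n\<close>.\<close>
  define a where "a j = (if j \<le> n then 1 - t ^ Suc j else 1 - t ^ (2 * n + 1 - j))" for j
  define c where "c j = (if j < n then K else d)" for j
  have a01: "0 \<le> a j \<and> a j \<le> 1" for j
    using t by (auto simp: a_def power_le_one mult_le_one)
  have "(1 + \<delta>) * (lam + c j) * a j \<le> m' * (lam * (if j = 0 then 0 else a (j - 1)) + c j * a (Suc j))"
    if j: "j < 2 * n + 1" for j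
  proof -
    have mono: ?thesis if "(lam + c j) * a j \<le> lam * (if j = 0 then 0 else a (j - 1)) + c j * a (Suc j)"
    proof -
      have "(1 + \<delta>) * ((lam + c j) * a j) \<le> m' * ((lam + c j) * a j)"
        using \<delta> lam a01[of j] by (intro mult_right_mono mult_nonneg_nonneg) auto
      also have "\<dots> \<le> m' * (lam * (if j = 0 then 0 else a (j - 1)) + c j * a (Suc j))"
        using that m' by (intro mult_left_mono) auto
      finally show ?thesis by (simp add: mult_ac)
    qed
    consider "j < n" | "j = n" | "n < j" by linarith
    then show ?thesis
    proof cases
      case 1
      have "0 \<le> (1 - t) * (K * t - lam)" using t by simp
      then have "lam + K * t\<^sup>2 \<le> (lam + K) * t" by (simp add: algebra_simps power2_eq_square)
      then have "t ^ j * (lam + K * t\<^sup>2) \<le> t ^ j * ((lam + K) * t)" using t by (intro mult_left_mono) auto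
      then have "(lam + c j) * a j \<le> lam * (1 - t ^ j) + c j * a (Suc j)"
        using 1 by (simp add: c_def a_def algebra_simps power2_eq_square)
      moreover have "(if j = 0 then 0 else a (j - 1)) = 1 - t ^ j"
        using 1 by (cases j) (auto simp: a_def)
      ultimately show ?thesis by (intro mono) simp
    next
      case 2
      \<comment> \<open>At the peak both neighbours have value \<open>1 - t ^ n\<close>; the loss is
        absorbed by \<open>m' > 1\<close>.\<close>
      have "(1 + \<delta>) * a n \<le> (1 + \<delta>) * 1" using a01[of n] \<delta> by (intro mult_left_mono) auto
      also have "\<dots> \<le> m' * (1 - t ^ n)" using n by simp
      finally have "(lam + d) * ((1 + \<delta>) * a n) \<le> (lam + d) * (m' * (1 - t ^ n))"
        using lam by (intro mult_left_mono) auto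
      then have "(1 + \<delta>) * (lam + d) * a n \<le> m' * (lam * (1 - t ^ n) + d * (1 - t ^ n))"
        by (simp add: algebra_simps)
      moreover have "a (n - 1) = 1 - t ^ n" "a (Suc n) = 1 - t ^ n" "n \<noteq> 0"
        by (auto simp: a_def n_def)
      ultimately show ?thesis using 2 by (simp add: c_def)
    next
      case 3
      obtain e where e: "2 * n + 1 - j = Suc e" using j by (cases "2 * n + 1 - j") auto
      have "0 \<le> (1 - t) * (lam * t - d)" using t by simp
      then have "lam * t\<^sup>2 + d \<le> (lam + d) * t" by (simp add: algebra_simps power2_eq_square)
      then have "t ^ e * (lam * t\<^sup>2 + d) \<le> t ^ e * ((lam + d) * t)" using t by (intro mult_left_mono) auto
      then have "(lam + d) * (1 - t ^ Suc e) \<le> lam * (1 - t ^ Suc (Suc e)) + d * (1 - t ^ e)"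
        by (simp add: algebra_simps power2_eq_square)
      moreover have "a (j - 1) = 1 - t ^ Suc (Suc e)"
      proof (cases "j = Suc n")
        case True
        then show ?thesis using e by (simp add: a_def)
      next
        case False
        then have "2 * n + 1 - (j - 1) = Suc (Suc e)" "\<not> j - 1 \<le> n" using 3 e by auto
        then show ?thesis by (simp add: a_def)
      qed
      moreover have "2 * n + 1 - Suc j = e" using e by simp
      then have "a (Suc j) = 1 - t ^ e" using 3 by (simp add: a_def del: One_nat_def)
      moreover have "a j = 1 - t ^ Suc e" using 3 e by (simp add: a_def)
      ultimately show ?thesis
        using 3 by (intro mono) (simp add: c_def del: power_Suc)
    qed
  qed
  \<comment> \<open>Truncated subtraction makes the exponent 0 from level \<open>2 * n + 1\<close>
    on.\<close>
  moreover have "a j = 0" if "2 * n + 1 \<le> j" for j using that by (simp add: a_def)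
  moreover have "0 < a 0" using t by (simp add: a_def)
  ultimately have "supercritical lam m' \<delta> (2 * n + 1) c a"
    using \<delta> m' a01 by (auto simp: supercritical_def)
  then show ?thesis using m' unfolding c_def by blast
qed

section \<open>The phase transition\<close>

lemma dmin_pos_pmf: "0 < pmf p (dmin p)"
proof -
  obtain k where "k \<in> set_pmf p" using set_pmf_not_empty[of p] by blast
  then have "0 < pmf p k" by (simp add: pmf_positive)
  then show ?thesis unfolding dmin_def by (rule LeastI)
qed

lemma AE_bgw_support: "AE \<kappa> in genealogies p. \<forall>y. \<kappa> y \<in> set_pmf p"
proof (subst AE_all_countable, rule allI)
  fix y :: "nat list"
  have "AE a in distr (genealogies p) (measure_pmf p) (\<lambda>\<kappa>. \<kappa> y). a \<in> set_pmf p"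
    unfolding distr_PiM_pmf_component[of "\<lambda>_. p" y] by (rule AE_measure_pmf)
  then show "AE \<kappa> in genealogies p. \<kappa> y \<in> set_pmf p"
    by (subst (asm) AE_distr_iff) auto
qed

text \<open>The constants \<open>t0\<close>, \<open>A\<close> and \<open>N\<close> depend neither on
  \<open>\<kappa>\<close> nor on \<open>x\<close>, so the exceptional null set is a countable union
  over the starting points \<open>y\<close> of the chain.\<close>

lemma AE_recurrent_if_supercritical:
  assumes p0: "pmf p 0 = 0"
    and mu: "pmf \<mu> 0 = 0" "pmf \<mu> 1 < 1" "integrable (measure_pmf \<mu>) real"
    and lam: "0 < lam"
    and m': "m' < measure_pmf.expectation \<mu> real"
    and sc: "supercritical lam m' \<delta> k c a"
    and c: "\<And>j. 0 < pmf p (c j)" and b: "\<And>j. c j \<le> b"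
  shows "AE \<kappa> in genealogies p. \<forall>x. in_tree \<kappa> x \<longrightarrow> brw_alpha \<kappa> lam \<mu> x = 1"
proof -
  obtain t0 where t0: "0 < t0" "t0 \<le> 1" "\<And>t. 0 \<le> t \<Longrightarrow> t \<le> t0 \<Longrightarrow> pgf \<mu> (1 - t) \<le> 1 - m' * t"
    using pgf_upper_bound[OF mu(3) m'] by blast
  define A where "A = 2 * (1 + lam)"
  have a0: "0 < a 0" using sc by (simp add: supercritical_def)
  have "\<forall>L. \<exists>n. (1 - 1 / A ^ L) ^ n * A ^ L \<le> t0 * a 0 / 2 * (1 / 2) ^ L"
    using t0 a0 lam by (intro allI absorption_time_exists) (auto simp: A_def)
  then obtain N where N: "\<And>L. (1 - 1 / A ^ L) ^ N L * A ^ L \<le> t0 * a 0 / 2 * (1 / 2) ^ L"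
    by metis
  have "AE \<kappa> in genealogies p. \<forall>y. (INF J. chain_alive lam k b c N y \<kappa> J) = 0"
    unfolding AE_all_countable by (intro allI AE_chain_dies c)
  then show ?thesis
    using AE_bgw_support[of p]
  proof eventually_elim
    case (elim \<kappa>)
    have pos: "0 < \<kappa> y" for y using elim(2) p0 by (metis gr0I pmf_eq_0_set_pmf)
    interpret biased_brw \<kappa> lam \<mu> "measure_pmf.expectation \<mu> real"
      by unfold_locales (use pos lam mu in auto)
    show ?case
    proof (intro allI impI)
      fix x assume "in_tree \<kappa> x"
      then show "brw_alpha \<kappa> lam \<mu> x = 1"
      proof (rule recurrent_if_chain_dies[where \<delta> = \<delta> and a = a and c = c and b = b])
        show "pgf \<mu> (1 - t) \<le> 1 - m' * t" if "0 \<le> t" "t \<le> t0" for t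
          using that by (rule t0(3))
        show "(1 + \<delta>) * (lam + c j) * a j \<le> m' * (lam * (if j = 0 then 0 else a (j - 1)) + c j * a (Suc j))"
          if "j < k" for j
          using sc that unfolding supercritical_def by blast
        show "A = 2 * (1 + lam)" by (rule A_def)
        show "(1 - 1 / A ^ L) ^ N L * A ^ L \<le> t0 * a 0 / 2 * (1 / 2) ^ L" for L by (rule N)
        show "(INF J. chain_alive lam k b c N y \<kappa> J) = 0" for y using elim(1) by blast
      qed (use sc b t0(1,2) in \<open>auto simp: supercritical_def\<close>)
    qed
  qed
qed

theorem theorem1p2:
  fixes p \<mu> :: "nat pmf" and lam m :: real
  assumes p0: "pmf p 0 = 0" and p1: "pmf p 1 < 1"
    and pmean: "integrable (measure_pmf p) real"
    and mu0: "pmf \<mu> 0 = 0" and mu1: "pmf \<mu> 1 < 1"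
    and mumean: "integrable (measure_pmf \<mu>) real"
    and m_def: "m = measure_pmf.expectation \<mu> real"
    and m_gt: "1 < m"
    and lam_pos: "0 < lam"
  shows "AE \<kappa> in bgw p.
    ((\<forall>x. in_tree \<kappa> x \<longrightarrow> brw_alpha \<kappa> lam \<mu> x = 0) \<longleftrightarrow>
       (lam < real (dmin p) \<and> m \<le> (real (dmin p) + lam) / (2 * sqrt (lam * real (dmin p)))))
    \<and> (\<not> (lam < real (dmin p) \<and> m \<le> (real (dmin p) + lam) / (2 * sqrt (lam * real (dmin p))))
         \<longrightarrow> (\<forall>x. in_tree \<kappa> x \<longrightarrow> brw_alpha \<kappa> lam \<mu> x = 1))"
proof -
  let ?d = "dmin p"
  let ?T = "lam < real ?d \<and> m \<le> (real ?d + lam) / (2 * sqrt (lam * real ?d))"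
  have d: "0 < ?d" using dmin_pos_pmf[of p] p0 by (auto intro: gr0I)
  have brw: "biased_brw \<kappa> lam \<mu> m" if "\<forall>y. \<kappa> y \<in> set_pmf p" for \<kappa>
  proof -
    have "0 < \<kappa> y" for y using that p0 by (metis gr0I pmf_eq_0_set_pmf)
    then show ?thesis by unfold_locales (use lam_pos mu0 mu1 mumean m_def in auto)
  qed
  have transient: "AE \<kappa> in genealogies p. \<forall>x. in_tree \<kappa> x \<longrightarrow> brw_alpha \<kappa> lam \<mu> x = 0" if T: ?T
    using AE_bgw_support[of p]
  proof eventually_elim
    case (elim \<kappa>)
    have "?d \<le> \<kappa> y" for y
      unfolding dmin_def using elim by (intro Least_le) (simp add: pmf_positive)
    then show ?case using biased_brw.transient[OF brw[OF elim]] T by blast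
  qed
  have recurrent: "AE \<kappa> in genealogies p. \<forall>x. in_tree \<kappa> x \<longrightarrow> brw_alpha \<kappa> lam \<mu> x = 1" if T: "\<not> ?T"
  proof (cases "(real ?d + lam) / (2 * sqrt (lam * real ?d)) < m")
    case True
    from supercritical_regular[OF lam_pos d this] obtain m' \<delta> k a
      where "m' < m" "supercritical lam m' \<delta> k (\<lambda>_. ?d) a" by blast
    then show ?thesis
      using AE_recurrent_if_supercritical[OF p0 mu0 mu1 mumean lam_pos, of m' \<delta> k "\<lambda>_. ?d" a ?d]
        dmin_pos_pmf[of p] by (simp add: m_def)
  next
    case False
    then have lam_d: "real ?d \<le> lam" using T by auto
    \<comment> \<open>At \<open>lam = dmin p\<close> the threshold equals 1 and \<open>m > 1\<close>
      exceeds it, so this case was already settled by the regular pattern.\<close>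
    have "real ?d \<noteq> lam"
    proof
      assume eq: "real ?d = lam"
      have "m \<le> (lam + lam) / (2 * sqrt (lam * lam))" using False by (simp only: eq not_less)
      also have "\<dots> = 1" using lam_pos by simp
      finally show False using m_gt by simp
    qed
    then have d_lam: "real ?d < lam" using lam_d by simp
    show ?thesis
    \<comment> \<open>A degree above \<open>lam\<close> allows traps; otherwise all degrees are at
      most \<open>lam\<close> and the walk itself is recurrent.\<close>
    proof (cases "\<exists>K\<in>set_pmf p. lam < real K")
      case True
      then obtain K where K: "K \<in> set_pmf p" "lam < real K" by blast
      from supercritical_trap[OF d d_lam K(2) m_gt] obtain m' \<delta> k a n
        where "m' < m" "supercritical lam m' \<delta> k (\<lambda>j. if j < n then K else ?d) a" by blast
      then show ?thesis
        using AE_recurrent_if_supercritical[OF p0 mu0 mu1 mumean lam_pos,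
            of m' \<delta> k "\<lambda>j. if j < n then K else ?d" a "max K ?d"]
          dmin_pos_pmf[of p] K(1) by (simp add: m_def pmf_positive)
    next
      case bounded: False
      show ?thesis
        using AE_bgw_support[of p]
      proof eventually_elim
        case (elim \<kappa>)
        then have "real (\<kappa> y) \<le> lam" for y using bounded by (auto simp: not_less)
        then show ?case using biased_brw.recurrent_if_kappa_le[OF brw[OF elim]] by blast
      qed
    qed
  qed
  show ?thesis
  proof (cases ?T)
    case True
    from transient[OF True] show ?thesis
      unfolding bgw_def by eventually_elim (use True in blast)
  next
    case False
    from recurrent[OF False] show ?thesis
      unfolding bgw_def
    proof eventually_elim
      case (elim \<kappa>)
      \<comment> \<open>The root lies in every tree, so strong recurrence excludes transience and
        gives the other direction of the equivalence.\<close>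
      have "brw_alpha \<kappa> lam \<mu> [] = 1" using elim in_tree_Nil by blast
      then have "\<not> (\<forall>x. in_tree \<kappa> x \<longrightarrow> brw_alpha \<kappa> lam \<mu> x = 0)" using in_tree_Nil[of \<kappa>] by force
      with elim False show ?case by blast
    qed
  qed
qed

end
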